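(* Let $\mathcal{F}=\{tK_2: t\ge 1\}$ be the family of matchings, and write $\mathrm{Lr}(n,G)=f(n,G|\mathcal{F})$. Then, as $n\to\infty$: (i) For every $p\ge 5$, $\mathrm{Lr}(n,K_p)=f(n,K_p|\mathcal{F})=(1+o(1))\,\mathrm{ex}(n,K_{\lceil p/2\rceil})$. (ii) For every $q\ge 2$, $\mathrm{Lr}(n,K_{2q})-\mathrm{Lr}(n,K_{2q-1})=o(n^2)$. (iii) $\mathrm{Lr}(n,K_4)=o(n^2)$. (iv) For every wheel graph $W_k=C_k+K_1$ with $k\ge 4$, $\mathrm{Lr}(n,W_k)=(1+o(1))\,n^2/4$.
   Context: All graphs are finite and simple; $|G|$ is the number of vertices of $G$. For a family $\mathcal{F}$ of graphs and $n\ge |G|$, $f(n,G|\mathcal{F})$ is the smallest positive integer $k$ such that in every edge coloring of $K_n$ using at least $k$ colors there is a (not necessarily induced) copy of $G$ in which, for each color occurring on it, the edges of that copy having that color form a member of $\mathcal{F}$. Thus $\mathrm{Lr}(n,G)$ is the smallest $k$ such that every edge coloring of $K_n$ with at least $k$ colors contains a properly edge-colored copy of $G$. $\mathrm{ex}(n,H)$ is the Turán number: the maximum number of edges in an $n$-vertex graph containing no subgraph isomorphic to $H$. In $C_k+K_1$, $+$ denotes the complete join: $W_k$ is a cycle of length $k$ together with one further vertex adjacent to all cycle vertices. *)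

theory Defs
  imports Complex_Main "HOL-Library.Ramsey" "HOL-Library.Landau_Symbols"
begin

text \<open>Graphs are pairs of a vertex set and a set of edges, the edges being two-element sets
  of vertices. As usual, \<open>nsets V 2\<close> is the set of all two-element subsets of \<open>V\<close>.\<close>

type_synonym 'a ugraph = "'a set \<times> 'a set set"

abbreviation verts :: "'a ugraph \<Rightarrow> 'a set" where "verts \<equiv> fst"
abbreviation edges :: "'a ugraph \<Rightarrow> 'a set set" where "edges \<equiv> snd"

definition simple_graph :: "'a ugraph \<Rightarrow> bool" where
  "simple_graph G \<longleftrightarrow> finite (verts G) \<and> edges G \<subseteq> nsets (verts G) 2"

definition graph_iso :: "'a ugraph \<Rightarrow> 'b ugraph \<Rightarrow> bool" where
  "graph_iso G H \<longleftrightarrow>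
     (\<exists>\<phi>. bij_betw \<phi> (verts G) (verts H) \<and> edges H = (\<lambda>e. \<phi> ` e) ` edges G)"

text \<open>The copies of \<open>G\<close> in \<open>H\<close>: subgraphs of \<open>H\<close>, not necessarily induced,
  that are isomorphic to \<open>G\<close>.\<close>

definition copies :: "'a ugraph \<Rightarrow> 'b ugraph \<Rightarrow> 'b ugraph set" where
  "copies G H = {S. verts S \<subseteq> verts H \<and> edges S \<subseteq> edges H \<and> graph_iso G S}"

definition complete_graph :: "nat \<Rightarrow> nat ugraph" where
  "complete_graph n = ({..<n}, nsets {..<n} 2)"

text \<open>A cycle only for \<open>k \<ge> 3\<close>.\<close>

definition cycle_graph :: "nat \<Rightarrow> nat ugraph" where
  "cycle_graph k = ({..<k}, {{i, Suc i mod k} | i. i < k})"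

definition graph_join :: "'a ugraph \<Rightarrow> 'b ugraph \<Rightarrow> ('a + 'b) ugraph" where
  "graph_join G H =
     (Inl ` verts G \<union> Inr ` verts H,
      (\<lambda>e. Inl ` e) ` edges G \<union> (\<lambda>e. Inr ` e) ` edges H
        \<union> {{Inl u, Inr v} | u v. u \<in> verts G \<and> v \<in> verts H})"

definition wheel_graph :: "nat \<Rightarrow> (nat + nat) ugraph" where
  "wheel_graph k = graph_join (cycle_graph k) (complete_graph 1)"

text \<open>The graph \<open>t K\<^sub>2\<close>, and the family of all these for \<open>t \<ge> 1\<close>. Families of graphs are given
  by representatives; membership is always tested up to isomorphism.\<close>

definition tK2 :: "nat \<Rightarrow> nat ugraph" where
  "tK2 t = ({..<2 * t}, {{2 * i, 2 * i + 1} | i. i < t})"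

definition matchings :: "nat ugraph set" where
  "matchings = {tK2 t | t. t \<ge> 1}"

text \<open>The graph formed by the edges of colour \<open>c\<close> in \<open>S\<close>. Its vertices are the endpoints of those
  edges only, so it has no isolated vertices.\<close>

definition colour_class :: "('a set \<Rightarrow> 'c) \<Rightarrow> 'a ugraph \<Rightarrow> 'c \<Rightarrow> 'a ugraph" where
  "colour_class \<chi> S c = (\<Union>{e \<in> edges S. \<chi> e = c}, {e \<in> edges S. \<chi> e = c})"

text \<open>The number \<open>f(n, G | F)\<close>. An edge colouring of \<open>K\<^sub>n\<close> is given by a function \<open>\<chi>\<close>, of which only
  the values on the edges of \<open>K\<^sub>n\<close> matter; natural numbers suffice as colours since there are
  finitely many edges. The minimum always exists, because no colouring uses more than
  \<open>n choose 2\<close> colours.\<close>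

definition f_num :: "nat \<Rightarrow> 'a ugraph \<Rightarrow> nat ugraph set \<Rightarrow> nat" where
  "f_num n G F = (LEAST k. k > 0 \<and>
     (\<forall>\<chi> :: nat set \<Rightarrow> nat. card (\<chi> ` edges (complete_graph n)) \<ge> k \<longrightarrow>
        (\<exists>S \<in> copies G (complete_graph n). \<forall>c \<in> \<chi> ` edges S.
           \<exists>M \<in> F. graph_iso (colour_class \<chi> S c) M)))"

definition Lr :: "nat \<Rightarrow> 'a ugraph \<Rightarrow> nat" where
  "Lr n G = f_num n G matchings"

text \<open>The Turan number. It is a proper maximum as soon as \<open>H\<close> has an edge, since then the edgeless
  graph contains no copy of \<open>H\<close>.\<close>

definition ex :: "nat \<Rightarrow> 'a ugraph \<Rightarrow> nat" where
  "ex n H = Max {card (edges G) | G :: nat ugraph.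
     simple_graph G \<and> verts G = {..<n} \<and> copies H G = {}}"

end

theory Submission
  imports Defs
begin

text \<open>
  A copy of \<open>G\<close> whose colour classes are matchings is the same as a properly coloured copy: any two of
  its edges of equal colour are disjoint. So \<open>Lr n G\<close> is governed by how many colours an edge
  colouring of \<open>K\<^sub>n\<close> can have without a properly coloured copy of \<open>G\<close>.

  Let \<open>r \<ge> 2\<close> and let \<open>p\<close> be \<open>2 * r - 1\<close> or \<open>2 * r\<close>. All statements about complete graphs follow from
  \<open>ex n K\<^sub>r \<le> Lr n K\<^sub>p \<le> ex n K\<^sub>r + o(n\<^sup>2)\<close>, proved in \<open>Lr_complete_graph_near_ex\<close>: for \<open>r = 2\<close> the Turan
  number is \<open>0\<close>, and for \<open>r \<ge> 3\<close> it has order \<open>n\<^sup>2\<close>, because the balanced complete bipartite graph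
  contains no \<open>K\<^sub>r\<close>.

  \<^emph>\<open>Lower bound\<close> (\<open>ex_less_Lr_complete_graph\<close>). Give the edges of an extremal \<open>K\<^sub>r\<close>-free graph distinct
  colours and all other edges one further colour. In a properly coloured clique the edges of this
  further colour form a matching, so a largest clique of the \<open>K\<^sub>r\<close>-free graph inside it contains at
  least half of its vertices; with \<open>2 * r - 1\<close> vertices that would be a \<open>K\<^sub>r\<close>.

  \<^emph>\<open>Upper bound\<close> (\<open>Lr_upper_bound\<close>). Choose one edge of each colour. If there are
  \<open>ex n K\<^sub>r + \<epsilon> * n\<^sup>2\<close> colours, then by \<open>erdos_stone\<close> these edges contain, for any prescribed \<open>t\<close>, a
  complete \<open>r\<close>-partite graph with parts of size \<open>t\<close>, and it is rainbow. Take a pair of vertices in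
  each part. The \<open>2 * r\<close> vertices span rainbow edges between the parts and one edge inside each part.
  The edges inside parts are disjoint, and each of them shares its colour with at most one rainbow
  edge; for large \<open>t\<close> the pairs can be chosen to avoid all these rainbow edges
  (\<open>conflict_free_pairs\<close>), and then the clique is properly coloured.

  The form of the Erdos--Stone theorem used here compares with \<open>ex n K\<^sub>r\<close> itself. A graph whose
  density exceeds the threshold for a pattern contains the pattern in a positive proportion of its
  vertex sets of some fixed size (\<open>dense_subsets\<close>). By pigeonhole, many of these occurrences differ
  in one vertex only, and together they form the pattern with that vertex replaced by \<open>t\<close> copies. So
  blowing up a vertex leaves the threshold unchanged (\<open>blow_up_one_part\<close>), and \<open>K\<^sub>r\<close> can be blown up
  vertex by vertex.

  For a wheel \<open>W\<^sub>k\<close> the upper bound is the same argument with \<open>r = 3\<close> together with Mantel's theorem: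
  \<open>W\<^sub>k\<close> becomes tripartite after the removal of at most one rim edge, which is placed inside a part.
  The lower bound comes from the rainbow balanced complete bipartite graph with one further colour:
  at most one spoke has this colour, so all rim vertices but at most one lie on the side opposite to the
  hub, and for \<open>k \<ge> 4\<close> two consecutive rim edges get the further colour.
\<close>

section \<open>Colour classes and proper copies\<close>

definition proper_on :: "('a set \<Rightarrow> 'c) \<Rightarrow> 'a set set \<Rightarrow> bool" where
  "proper_on \<chi> E \<longleftrightarrow> (\<forall>e\<in>E. \<forall>e'\<in>E. e \<noteq> e' \<and> \<chi> e = \<chi> e' \<longrightarrow> e \<inter> e' = {})"

lemma graph_iso_sym:
  assumes "graph_iso G H" and "\<And>e. e \<in> edges G \<Longrightarrow> e \<subseteq> verts G"
  shows "graph_iso H G"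
proof -
  obtain \<phi> where bij: "bij_betw \<phi> (verts G) (verts H)"
    and edges: "edges H = (\<lambda>e. \<phi> ` e) ` edges G"
    using assms(1) by (auto simp: graph_iso_def)
  let ?\<psi> = "inv_into (verts G) \<phi>"
  have "?\<psi> ` \<phi> ` e = e" if "e \<in> edges G" for e
    using bij assms(2)[OF that] by (simp add: bij_betw_def)
  hence "edges G = (\<lambda>e. ?\<psi> ` e) ` edges H"
    by (force simp: edges image_image)
  thus ?thesis
    unfolding graph_iso_def using bij_betw_inv_into[OF bij] by blast
qed

text \<open>
  The isomorphism enumerates the edges and sends \<open>2 * i\<close> and \<open>2 * i + 1\<close> to the two ends of the
  \<open>i\<close>-th edge.
\<close>

lemma disjoint_pairs_iso_tK2:
  assumes "finite E" "E \<noteq> {}" and card2: "\<And>e. e \<in> E \<Longrightarrow> card e = 2"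
    and disj: "\<And>e e'. e \<in> E \<Longrightarrow> e' \<in> E \<Longrightarrow> e \<noteq> e' \<Longrightarrow> e \<inter> e' = {}"
  shows "\<exists>M\<in>matchings. graph_iso (\<Union>E, E) M"
proof -
  define t where "t = card E"
  have "t \<ge> 1" using assms(1,2) by (simp add: t_def Suc_le_eq card_gt_0_iff)
  obtain h where h: "bij_betw h {..<t} E"
    using ex_bij_betw_nat_finite[OF assms(1)] by (auto simp: t_def lessThan_atLeast0)
  have "\<exists>u v. e = {u, v} \<and> u \<noteq> v" if "e \<in> E" for e
    using card2[OF that] by (auto simp: card_2_iff)
  then obtain u v where uv: "\<And>e. e \<in> E \<Longrightarrow> e = {u e, v e}" "\<And>e. e \<in> E \<Longrightarrow> u e \<noteq> v e"
    by metis
  define \<psi> where "\<psi> k = (if even k then u (h (k div 2)) else v (h (k div 2)))" for k :: nat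
  have hE: "h i \<in> E" if "i < t" for i using h that by (auto simp: bij_betw_def)
  have \<psi>_in: "\<psi> k \<in> h (k div 2)" if "k < 2 * t" for k
  proof -
    have "h (k div 2) = {u (h (k div 2)), v (h (k div 2))}"
      using uv(1)[OF hE[of "k div 2"]] that by simp
    thus ?thesis unfolding \<psi>_def by (metis insertCI)
  qed
  have "inj_on \<psi> {..<2 * t}"
  proof (rule inj_onI)
    fix k l assume kl: "k \<in> {..<2 * t}" "l \<in> {..<2 * t}" "\<psi> k = \<psi> l"
    have "h (k div 2) = h (l div 2)"
      using disj[OF hE[of "k div 2"] hE[of "l div 2"]] \<psi>_in[of k] \<psi>_in[of l] kl
      by force
    hence eq: "k div 2 = l div 2"
      using h kl by (auto simp: bij_betw_def inj_on_def)
    have "even k = even l"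
      using kl uv(2)[OF hE[of "l div 2"]] by (auto simp: \<psi>_def eq split: if_splits)
    thus "k = l" using eq by presburger
  qed
  moreover have pair: "{\<psi> (2 * i), \<psi> (2 * i + 1)} = h i" if "i < t" for i
    using uv(1)[OF hE[OF that]] by (simp add: \<psi>_def)
  have "\<psi> ` {..<2 * t} = \<Union>E"
  proof (intro equalityI subsetI)
    fix x assume "x \<in> \<psi> ` {..<2 * t}"
    then obtain k where k: "k < 2 * t" "x = \<psi> k" by auto
    thus "x \<in> \<Union>E" using \<psi>_in[of k] hE[of "k div 2"] by auto
  next
    fix x assume "x \<in> \<Union>E"
    then obtain e where "e \<in> E" "x \<in> e" by auto
    then obtain i where i: "i < t" "x \<in> h i" using h by (auto simp: bij_betw_def)
    hence "x = \<psi> (2 * i) \<or> x = \<psi> (2 * i + 1)" using pair by blast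
    thus "x \<in> \<psi> ` {..<2 * t}" using i(1) by auto
  qed
  moreover have "E = (\<lambda>e. \<psi> ` e) ` {{2 * i, 2 * i + 1} | i. i < t}"
  proof -
    have "(\<lambda>e. \<psi> ` e) ` {{2 * i, 2 * i + 1} | i. i < t} = {{\<psi> (2 * i), \<psi> (2 * i + 1)} | i. i < t}"
      unfolding setcompr_eq_image image_image by simp
    also have "\<dots> = h ` {..<t}"
      unfolding setcompr_eq_image using pair by (intro image_cong) auto
    finally show ?thesis using h by (simp add: bij_betw_def)
  qed
  ultimately have "graph_iso (tK2 t) (\<Union>E, E)"
    unfolding graph_iso_def tK2_def by (auto simp: bij_betw_def)
  hence "graph_iso (\<Union>E, E) (tK2 t)"
    by (rule graph_iso_sym) (auto simp: tK2_def)
  thus ?thesis using \<open>t \<ge> 1\<close> unfolding matchings_def by blast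
qed

lemma iso_tK2_imp_disjoint:
  assumes "graph_iso (\<Union>E, E) (tK2 t)" "e \<in> E" "e' \<in> E" "e \<noteq> e'"
  shows "e \<inter> e' = {}"
proof (rule ccontr)
  assume "e \<inter> e' \<noteq> {}"
  then obtain x where x: "x \<in> e" "x \<in> e'" by blast
  obtain \<phi> where inj: "inj_on \<phi> (\<Union>E)"
    and edges: "{{2 * i, 2 * i + 1} | i. i < t} = (\<lambda>e. \<phi> ` e) ` E"
    using assms(1) by (auto simp: graph_iso_def tK2_def bij_betw_def)
  have "\<exists>i. \<phi> ` d = {2 * i, 2 * i + 1}" if "d \<in> E" for d
  proof -
    have "\<phi> ` d \<in> {{2 * i, 2 * i + 1} | i. i < t}"
      unfolding edges by (rule imageI[OF that])
    thus ?thesis by blast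
  qed
  then obtain i j where ij: "\<phi> ` e = {2 * i, 2 * i + 1}" "\<phi> ` e' = {2 * j, 2 * j + 1}"
    using assms(2,3) by meson
  have "\<phi> x \<in> {2 * i, 2 * i + 1}" "\<phi> x \<in> {2 * j, 2 * j + 1}"
    using x ij by (metis imageI)+
  hence "i = j" by (elim insertE emptyE; presburger)
  hence "\<phi> ` e = \<phi> ` e'" using ij by simp
  thus False using inj_on_image_eq_iff[OF inj] assms(2-4) by blast
qed

lemma matching_classes_iff_proper:
  assumes "finite (edges S)" "\<And>e. e \<in> edges S \<Longrightarrow> card e = 2"
  shows "(\<forall>c\<in>\<chi> ` edges S. \<exists>M\<in>matchings. graph_iso (colour_class \<chi> S c) M)
    \<longleftrightarrow> proper_on \<chi> (edges S)"
proof
  assume L: "\<forall>c\<in>\<chi> ` edges S. \<exists>M\<in>matchings. graph_iso (colour_class \<chi> S c) M"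
  show "proper_on \<chi> (edges S)"
    unfolding proper_on_def
  proof (intro ballI impI)
    fix e e' assume e: "e \<in> edges S" "e' \<in> edges S" "e \<noteq> e' \<and> \<chi> e = \<chi> e'"
    obtain t where "graph_iso (colour_class \<chi> S (\<chi> e)) (tK2 t)"
      using L e(1) by (force simp: matchings_def)
    thus "e \<inter> e' = {}"
      unfolding colour_class_def by (rule iso_tK2_imp_disjoint) (use e in auto)
  qed
next
  assume R: "proper_on \<chi> (edges S)"
  show "\<forall>c\<in>\<chi> ` edges S. \<exists>M\<in>matchings. graph_iso (colour_class \<chi> S c) M"
  proof
    fix c assume "c \<in> \<chi> ` edges S"
    thus "\<exists>M\<in>matchings. graph_iso (colour_class \<chi> S c) M"
      unfolding colour_class_def
      by (intro disjoint_pairs_iso_tK2) (use assms R in \<open>auto simp: proper_on_def\<close>)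
  qed
qed

lemma copy_edges:
  assumes "S \<in> copies G (complete_graph n)"
  shows "finite (edges S)" "\<And>e. e \<in> edges S \<Longrightarrow> card e = 2"
proof -
  have sub: "edges S \<subseteq> nsets {..<n} 2"
    using assms by (auto simp: copies_def complete_graph_def)
  thus "finite (edges S)" by (rule finite_subset) (simp add: finite_imp_finite_nsets)
  show "card e = 2" if "e \<in> edges S" for e using that sub by (auto simp: nsets_def)
qed

text \<open>
  This replaces the isomorphism condition on colour classes by properness once and for all.
\<close>

lemma Lr_alt:
  "Lr n G = (LEAST k. k > 0 \<and> (\<forall>\<chi> :: nat set \<Rightarrow> nat. card (\<chi> ` nsets {..<n} 2) \<ge> k \<longrightarrow>
     (\<exists>S \<in> copies G (complete_graph n). proper_on \<chi> (edges S))))"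
proof -
  have *: "(\<exists>S \<in> copies G (complete_graph n). \<forall>c \<in> \<chi> ` edges S.
           \<exists>M \<in> matchings. graph_iso (colour_class \<chi> S c) M) \<longleftrightarrow>
      (\<exists>S \<in> copies G (complete_graph n). proper_on \<chi> (edges S))" for \<chi> :: "nat set \<Rightarrow> nat"
    by (intro bex_cong refl matching_classes_iff_proper) (auto dest: copy_edges)
  show ?thesis
    unfolding Lr_def f_num_def * by (simp add: complete_graph_def)
qed

lemma Lr_le:
  assumes "k > 0"
    and "\<And>\<chi> :: nat set \<Rightarrow> nat. card (\<chi> ` nsets {..<n} 2) \<ge> k \<Longrightarrow>
       \<exists>S \<in> copies G (complete_graph n). proper_on \<chi> (edges S)"
  shows "Lr n G \<le> k"
  unfolding Lr_alt by (rule Least_le) (use assms in blast)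

text \<open>
  The minimum in the definition exists because the condition holds vacuously above the number
  of edges of \<open>K\<^sub>n\<close>; the given colouring then violates it for every \<open>k \<le> m\<close>.
\<close>

lemma less_Lr:
  fixes \<chi> :: "nat set \<Rightarrow> nat"
  assumes "card (\<chi> ` nsets {..<n} 2) \<ge> m"
    and "\<And>S. S \<in> copies G (complete_graph n) \<Longrightarrow> \<not> proper_on \<chi> (edges S)"
  shows "m < Lr n G"
proof -
  let ?P = "\<lambda>k. k > 0 \<and> (\<forall>\<chi> :: nat set \<Rightarrow> nat. card (\<chi> ` nsets {..<n} 2) \<ge> k \<longrightarrow>
     (\<exists>S \<in> copies G (complete_graph n). proper_on \<chi> (edges S)))"
  have "?P (Suc (card (nsets {..<n} 2)))"
    using card_image_le[of "nsets {..<n} 2"]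
    by (meson Suc_n_not_le_n finite_imp_finite_nsets finite_lessThan le_trans zero_less_Suc)
  hence "?P (Lr n G)" unfolding Lr_alt by (rule LeastI)
  thus ?thesis using assms by (meson le_trans not_le_imp_less)
qed

lemma iso_complete_graph_iff:
  "graph_iso (complete_graph p) S \<longleftrightarrow>
     finite (verts S) \<and> card (verts S) = p \<and> edges S = nsets (verts S) 2"
proof
  assume "graph_iso (complete_graph p) S"
  then obtain \<phi> where \<phi>: "bij_betw \<phi> {..<p} (verts S)"
      "edges S = (\<lambda>e. \<phi> ` e) ` nsets {..<p} 2"
    by (auto simp: graph_iso_def complete_graph_def)
  moreover have "(\<lambda>e. \<phi> ` e) ` nsets {..<p} 2 = nsets (verts S) 2"
    using bij_betw_nsets[OF \<phi>(1)] by (simp add: bij_betw_def)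
  ultimately show "finite (verts S) \<and> card (verts S) = p \<and> edges S = nsets (verts S) 2"
    using bij_betw_finite[OF \<phi>(1)] bij_betw_same_card[OF \<phi>(1)] by simp
next
  assume S: "finite (verts S) \<and> card (verts S) = p \<and> edges S = nsets (verts S) 2"
  then obtain \<phi> where \<phi>: "bij_betw \<phi> {..<p} (verts S)"
    using ex_bij_betw_nat_finite[of "verts S"] by (auto simp: lessThan_atLeast0)
  moreover have "edges S = (\<lambda>e. \<phi> ` e) ` nsets {..<p} 2"
    using bij_betw_nsets[OF \<phi>] S by (simp add: bij_betw_def)
  ultimately show "graph_iso (complete_graph p) S"
    by (auto simp: graph_iso_def complete_graph_def)
qed

lemma copies_complete_graph:
  "copies (complete_graph p) H =
     {(W, nsets W 2) | W. W \<subseteq> verts H \<and> nsets W 2 \<subseteq> edges H \<and> finite W \<and> card W = p}"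
  unfolding copies_def iso_complete_graph_iff by (auto simp: prod_eq_iff)

section \<open>Blowing up patterns above their density threshold\<close>

text \<open>
  The complete \<open>r\<close>-partite graph with parts of sizes \<open>s 0, \<dots>, s (r - 1)\<close> as a subgraph. The parts are
  automatically disjoint if \<open>E\<close> consists of two-element sets, since a common vertex would be a loop.
\<close>

definition multipartite_in :: "nat \<Rightarrow> (nat \<Rightarrow> nat) \<Rightarrow> 'a set \<Rightarrow> 'a set set \<Rightarrow> bool" where
  "multipartite_in r s V E \<longleftrightarrow> (\<exists>A. (\<forall>i<r. A i \<subseteq> V \<and> card (A i) = s i) \<and>
     (\<forall>i<r. \<forall>j<r. i \<noteq> j \<longrightarrow> (\<forall>x\<in>A i. \<forall>y\<in>A j. {x, y} \<in> E)))"

lemma multipartite_in_mono: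
  assumes "multipartite_in r s V E" "V \<subseteq> V'" "E \<subseteq> E'"
  shows "multipartite_in r s V' E'"
proof -
  obtain A where "\<forall>i<r. A i \<subseteq> V \<and> card (A i) = s i"
    "\<forall>i<r. \<forall>j<r. i \<noteq> j \<longrightarrow> (\<forall>x\<in>A i. \<forall>y\<in>A j. {x, y} \<in> E)"
    using assms(1) unfolding multipartite_in_def by blast
  thus ?thesis unfolding multipartite_in_def using assms(2,3) by (intro exI[of _ A]) blast
qed

lemma multipartite_in_cong:
  assumes "\<And>i. i < r \<Longrightarrow> s i = s' i"
  shows "multipartite_in r s = multipartite_in r s'"
  using assms unfolding multipartite_in_def by (intro ext) simp

text \<open>
  The number \<open>a\<close> is an asymptotic edge density, relative to \<open>n choose 2\<close>, above which every large
  graph has the property \<open>P\<close>.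
\<close>

definition forced_above :: "real \<Rightarrow> ('a set \<Rightarrow> 'a set set \<Rightarrow> bool) \<Rightarrow> bool" where
  "forced_above a P \<longleftrightarrow> (\<forall>\<epsilon>>0. \<exists>N. \<forall>V E. finite V \<longrightarrow> N \<le> card V \<longrightarrow> E \<subseteq> nsets V 2 \<longrightarrow>
     (a + \<epsilon>) * real (card V choose 2) \<le> real (card E) \<longrightarrow> P V E)"

lemma card_supersets_of_pair:
  assumes "finite V" "e \<in> nsets V 2" "2 \<le> m"
  shows "card {M \<in> nsets V m. e \<subseteq> M} = (card V - 2) choose (m - 2)"
proof -
  have e: "e \<subseteq> V" "card e = 2" "finite e" using assms(2) by (auto simp: nsets_def)
  have "bij_betw (\<lambda>M. M - e) {M \<in> nsets V m. e \<subseteq> M} (nsets (V - e) (m - 2))"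
  proof (rule bij_betw_byWitness[where f' = "\<lambda>L. L \<union> e"])
    show "(\<lambda>M. M - e) ` {M \<in> nsets V m. e \<subseteq> M} \<subseteq> nsets (V - e) (m - 2)"
      using e by (auto simp: nsets_def card_Diff_subset)
    show "(\<lambda>L. L \<union> e) ` nsets (V - e) (m - 2) \<subseteq> {M \<in> nsets V m. e \<subseteq> M}"
    proof safe
      fix L assume L: "L \<in> nsets (V - e) (m - 2)"
      have "card (L \<union> e) = card L + card e"
        by (rule card_Un_disjoint) (use L e in \<open>auto simp: nsets_def\<close>)
      thus "L \<union> e \<in> nsets V m" using L e assms(3) by (auto simp: nsets_def)
    qed
  qed (use e in \<open>auto simp: nsets_def\<close>)
  hence "card {M \<in> nsets V m. e \<subseteq> M} = card (nsets (V - e) (m - 2))"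
    by (rule bij_betw_same_card)
  also have "\<dots> = (card V - 2) choose (m - 2)"
    using e by (simp add: card_nsets card_Diff_subset)
  finally show ?thesis .
qed

text \<open>
  Double counting pairs of an edge and an \<open>m\<close>-set containing it shows that the average density of an
  induced subgraph on \<open>m\<close> vertices is the density of the whole graph. If it exceeds \<open>a\<close> by \<open>\<epsilon>\<close>, then
  at least a proportion \<open>\<epsilon>\<close> of the \<open>m\<close>-sets have density \<open>a\<close> or more, as no density exceeds \<open>1\<close>.
\<close>

lemma dense_subsets:
  assumes V: "finite V" and m: "2 \<le> m" "m \<le> card V" and E: "E \<subseteq> nsets V 2"
    and a: "a \<ge> 0" and dense: "(a + \<epsilon>) * real (card V choose 2) \<le> real (card E)"
  shows "\<epsilon> * real (card V choose m)
    \<le> real (card {M \<in> nsets V m. a * real (m choose 2) \<le> real (card (E \<inter> nsets M 2))})"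
proof -
  define n where "n = card V"
  define \<G> where "\<G> = {M \<in> nsets V m. a * real (m choose 2) \<le> real (card (E \<inter> nsets M 2))}"
  have fin: "finite (nsets V m)" "finite E"
    using V E by (auto intro: finite_subset simp: finite_imp_finite_nsets)
  have \<G>: "\<G> \<subseteq> nsets V m" by (auto simp: \<G>_def)
  have pos: "real (m choose 2) > 0" using m by simp
  have edges_in: "E \<inter> nsets M 2 = {e \<in> E. e \<subseteq> M}" if "M \<in> nsets V m" for M
    using E by (auto simp: nsets_def)
  have "(\<Sum>M\<in>nsets V m. card {e \<in> E. e \<subseteq> M}) = (\<Sum>e\<in>E. (n - 2) choose (m - 2))"
    by (rule sum_multicount_gen)
      (use fin E card_supersets_of_pair[OF V _ m(1)] in \<open>auto simp: n_def\<close>)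
  hence count: "(\<Sum>M\<in>nsets V m. card (E \<inter> nsets M 2)) = card E * ((n - 2) choose (m - 2))"
    using edges_in by simp
  have "(a + \<epsilon>) * (real (n choose m) * real (m choose 2))
      = ((a + \<epsilon>) * real (n choose 2)) * real ((n - 2) choose (m - 2))"
    using choose_mult[OF m, folded n_def] by (simp add: of_nat_mult[symmetric] del: of_nat_mult)
  also have "\<dots> \<le> real (card E) * real ((n - 2) choose (m - 2))"
    using dense by (intro mult_right_mono) (auto simp: n_def)
  also have "\<dots> = (\<Sum>M\<in>nsets V m. real (card (E \<inter> nsets M 2)))"
    using count by (metis of_nat_mult of_nat_sum)
  also have "\<dots> = (\<Sum>M\<in>\<G>. real (card (E \<inter> nsets M 2)))
      + (\<Sum>M\<in>nsets V m - \<G>. real (card (E \<inter> nsets M 2)))"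
    using sum.subset_diff[OF \<G> fin(1)] by (simp add: add.commute)
  also have "\<dots> \<le> (\<Sum>M\<in>\<G>. real (m choose 2)) + (\<Sum>M\<in>nsets V m - \<G>. a * real (m choose 2))"
  proof (intro add_mono sum_mono)
    fix M assume "M \<in> \<G>"
    hence M: "finite M" "card M = m" using \<G> by (auto simp: nsets_def)
    have "card (E \<inter> nsets M 2) \<le> card (nsets M 2)"
      by (rule card_mono) (use M in \<open>auto simp: finite_imp_finite_nsets\<close>)
    thus "real (card (E \<inter> nsets M 2)) \<le> real (m choose 2)" using M by (simp add: card_nsets)
  qed (auto simp: \<G>_def)
  also have "\<dots> \<le> (real (card \<G>) + a * real (n choose m)) * real (m choose 2)"
  proof -
    have "card (nsets V m - \<G>) \<le> n choose m"
      using card_mono[OF fin(1) Diff_subset] by (simp add: card_nsets n_def)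
    hence "a * real (card (nsets V m - \<G>)) \<le> a * real (n choose m)"
      using a by (intro mult_left_mono) auto
    hence "a * real (card (nsets V m - \<G>)) * real (m choose 2)
        \<le> a * real (n choose m) * real (m choose 2)"
      by (rule mult_right_mono) simp
    thus ?thesis by (simp add: algebra_simps)
  qed
  finally have "\<epsilon> * real (n choose m) * real (m choose 2) \<le> real (card \<G>) * real (m choose 2)"
    by (simp add: algebra_simps)
  thus ?thesis using pos by (simp add: n_def \<G>_def)
qed

lemma large_fibre:
  assumes "finite A" "finite B" "f ` A \<subseteq> B" "card B * t < card A"
  shows "\<exists>y\<in>B. t < card {x \<in> A. f x = y}"
proof -
  have "B \<noteq> {}" using assms(3,4) by auto
  then obtain y where y: "y \<in> B" "card A \<le> card (f -` {y} \<inter> A) * card B"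
    using pigeonhole_card[of f A B] assms(1-3) by blast
  have "f -` {y} \<inter> A = {x \<in> A. f x = y}" by auto
  moreover have "t < card (f -` {y} \<inter> A)"
    using y(2) assms(4) by (metis less_le_trans mult.commute mult_less_cancel2)
  ultimately show ?thesis using y(1) by auto
qed

text \<open>
  Fix \<open>m\<close> such that all graphs on \<open>m\<close> vertices of density at least \<open>a + \<epsilon> / 2\<close> contain the pattern. In
  a graph of density at least \<open>a + \<epsilon>\<close> a positive proportion of all \<open>m\<close>-sets \<open>M\<close> contains it; let \<open>x M\<close> be the vertex that forms
  part \<open>i\<close>. Assign to \<open>M\<close> the set \<open>M - {x M}\<close> together with the other parts. There are only
  \<open>O(n ^ (m - 1))\<close> such values but of order \<open>n ^ m\<close> sets \<open>M\<close>, so some \<open>t\<close> sets share the same value. They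
  differ exactly in \<open>x M\<close>, and these \<open>t\<close> vertices form the enlarged part.
\<close>

lemma blow_up_one_part:
  fixes P :: "'a set \<Rightarrow> 'a set set \<Rightarrow> bool"
  assumes forced: "forced_above a (multipartite_in r s :: 'a set \<Rightarrow> 'a set set \<Rightarrow> bool)"
    and "i < r" "s i = 1" "a \<ge> 0"
  shows "forced_above a (multipartite_in r (s(i := t)) :: 'a set \<Rightarrow> 'a set set \<Rightarrow> bool)"
  unfolding forced_above_def
proof (intro allI impI)
  fix \<epsilon> :: real assume "\<epsilon> > 0"
  hence "\<epsilon> / 2 > 0" by simp
  with forced obtain N where N: "\<And>V (E :: 'a set set). finite V \<Longrightarrow> N \<le> card V \<Longrightarrow> E \<subseteq> nsets V 2 \<Longrightarrow>
      (a + \<epsilon> / 2) * real (card V choose 2) \<le> real (card E) \<Longrightarrow> multipartite_in r s V E"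
    unfolding forced_above_def by metis
  define m where "m = max N 2"
  define J where "J = {..<r} - {i}"
  define K where "K = (2 ^ (m - 1)) ^ card J * t"
  \<comment> \<open>\<open>K\<close> is \<open>t\<close> times the number of choices of the other parts within a set of \<open>m - 1\<close> vertices, and
    \<open>N'\<close> is such that \<open>m * K < \<epsilon> / 2 * (n - (m - 1))\<close> for \<open>n \<ge> N'\<close>. By the absorption identity
    \<open>m * (n choose m) = (n - (m - 1)) * (n choose (m - 1))\<close> the good sets outnumber the codes \<open>t\<close> to one.\<close>
  define N' where "N' = m + nat \<lceil>2 * real (m * K) / \<epsilon>\<rceil>"
  have m: "2 \<le> m" "N \<le> m" by (auto simp: m_def)
  show "\<exists>N. \<forall>V E. finite V \<longrightarrow> N \<le> card V \<longrightarrow> E \<subseteq> nsets (V :: 'a set) 2 \<longrightarrow>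
     (a + \<epsilon>) * real (card V choose 2) \<le> real (card E) \<longrightarrow> multipartite_in r (s(i := t)) V E"
  proof (intro exI[of _ N'] allI impI)
    fix V :: "'a set" and E
    assume V: "finite V" "N' \<le> card V" and E: "E \<subseteq> nsets V 2"
      and dense: "(a + \<epsilon>) * real (card V choose 2) \<le> real (card E)"
    define n where "n = card V"
    have "m \<le> n" using V(2) by (simp add: N'_def n_def)
    define \<G> where
      "\<G> = {M \<in> nsets V m. (a + \<epsilon> / 2) * real (m choose 2) \<le> real (card (E \<inter> nsets M 2))}"
    have "finite \<G>" using V(1) by (auto simp: \<G>_def finite_imp_finite_nsets)
    have many: "\<epsilon> / 2 * real (n choose m) \<le> real (card \<G>)"
      unfolding \<G>_def n_def
      by (rule dense_subsets[OF V(1) m(1) _ E])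
        (use dense \<open>m \<le> n\<close> \<open>a \<ge> 0\<close> \<open>\<epsilon> > 0\<close> in \<open>auto simp: n_def add.commute\<close>)
    have "\<forall>M\<in>\<G>. \<exists>A. (\<forall>j<r. A j \<subseteq> M \<and> card (A j) = s j) \<and>
       (\<forall>j<r. \<forall>k<r. j \<noteq> k \<longrightarrow> (\<forall>x\<in>A j. \<forall>y\<in>A k. {x, y} \<in> E))"
    proof
      fix M assume "M \<in> \<G>"
      hence M: "finite M" "card M = m" by (auto simp: \<G>_def nsets_def)
      have "multipartite_in r s M (E \<inter> nsets M 2)"
        by (rule N) (use \<open>M \<in> \<G>\<close> M m in \<open>auto simp: \<G>_def\<close>)
      hence "multipartite_in r s M E" by (rule multipartite_in_mono) auto
      thus "\<exists>A. (\<forall>j<r. A j \<subseteq> M \<and> card (A j) = s j) \<and>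
        (\<forall>j<r. \<forall>k<r. j \<noteq> k \<longrightarrow> (\<forall>x\<in>A j. \<forall>y\<in>A k. {x, y} \<in> E))"
        unfolding multipartite_in_def .
    qed
    from bchoice[OF this] obtain A where
      *: "\<forall>M\<in>\<G>. (\<forall>j<r. A M j \<subseteq> M \<and> card (A M j) = s j) \<and>
       (\<forall>j<r. \<forall>k<r. j \<noteq> k \<longrightarrow> (\<forall>x\<in>A M j. \<forall>y\<in>A M k. {x, y} \<in> E))" ..
    have A: "A M j \<subseteq> M" "card (A M j) = s j" if "M \<in> \<G>" "j < r" for M j
      using * that by blast+
    have cross: "{x, y} \<in> E"
      if "M \<in> \<G>" "j < r" "k < r" "j \<noteq> k" "x \<in> A M j" "y \<in> A M k" for M j k x y
      using * that by blast
    have "\<exists>x. A M i = {x}" if "M \<in> \<G>" for M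
      using A(2)[OF that \<open>i < r\<close>] \<open>s i = 1\<close> by (simp add: card_1_singleton_iff)
    then obtain x where x: "\<And>M. M \<in> \<G> \<Longrightarrow> A M i = {x M}" by metis
    have xM: "x M \<in> M" if "M \<in> \<G>" for M using A(1)[OF that \<open>i < r\<close>] x[OF that] by auto
    define code where "code M = (M - {x M}, restrict (A M) J)" for M
    define \<C> where "\<C> = (SIGMA L:nsets V (m - 1). J \<rightarrow>\<^sub>E Pow L)"
    have J: "finite J" by (simp add: J_def)
    have finPow: "finite (J \<rightarrow>\<^sub>E Pow L)" "card (J \<rightarrow>\<^sub>E Pow L) = (2 ^ (m - 1)) ^ card J"
      if "L \<in> nsets V (m - 1)" for L
      using that J by (auto simp: nsets_def card_PiE card_Pow intro!: finite_PiE)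
    have "finite \<C>" unfolding \<C>_def
      using finPow V(1) by (auto simp: finite_imp_finite_nsets intro!: finite_SigmaI)
    have "card \<C> = (\<Sum>L\<in>nsets V (m - 1). card (J \<rightarrow>\<^sub>E Pow L))"
      unfolding \<C>_def using finPow V(1) by (intro card_SigmaI) (auto simp: finite_imp_finite_nsets)
    also have "\<dots> = (n choose (m - 1)) * (2 ^ (m - 1)) ^ card J"
      using finPow(2) by (simp add: card_nsets n_def)
    finally have card\<C>: "card \<C> * t = (n choose (m - 1)) * K" by (simp add: K_def)
    have "code ` \<G> \<subseteq> \<C>"
    proof (rule image_subsetI)
      fix M assume M: "M \<in> \<G>"
      have "M - {x M} \<in> nsets V (m - 1)"
        using M xM[OF M] by (auto simp: \<G>_def nsets_def)
      moreover have "A M j \<subseteq> M - {x M}" if "j \<in> J" for j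
      proof -
        have j: "j < r" "j \<noteq> i" using that by (auto simp: J_def)
        have "x M \<notin> A M j"
        proof
          assume "x M \<in> A M j"
          hence "{x M, x M} \<in> E" using cross[OF M \<open>i < r\<close> j(1), of "x M" "x M"] j(2) x[OF M] by simp
          thus False using E by (auto simp: nsets_def)
        qed
        thus ?thesis using A(1)[OF M j(1)] by auto
      qed
      ultimately show "code M \<in> \<C>" by (auto simp: code_def \<C>_def)
    qed
    moreover have "card \<C> * t < card \<G>"
    proof -
      have "n - (m - 1) > 0" using \<open>m \<le> n\<close> m by simp
      have "2 * real (m * K) / \<epsilon> \<le> real (nat \<lceil>2 * real (m * K) / \<epsilon>\<rceil>)" by linarith
      also have "\<dots> \<le> real n - real m" using V(2) \<open>m \<le> n\<close> by (simp add: N'_def n_def)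
      also have "\<dots> < real (n - (m - 1))" using m \<open>m \<le> n\<close> by simp
      finally have "real m * real K < \<epsilon> / 2 * real (n - (m - 1))"
        using \<open>\<epsilon> > 0\<close> by (simp add: field_simps)
      moreover have pos: "real (n choose (m - 1)) > 0" using \<open>m \<le> n\<close> by simp
      ultimately have "real m * real K * real (n choose (m - 1))
          < \<epsilon> / 2 * real (n - (m - 1)) * real (n choose (m - 1))"
        by (rule mult_strict_right_mono)
      also have "\<dots> = \<epsilon> / 2 * (real m * real (n choose m))"
        using binomial_absorb_comp[of n "m - 1"] binomial_absorption[of "m - 1" n] m
        by (simp flip: of_nat_mult)
      finally have "real m * (real K * real (n choose (m - 1))) < real m * (\<epsilon> / 2 * real (n choose m))"
        by (simp add: mult_ac)
      hence "real K * real (n choose (m - 1)) < \<epsilon> / 2 * real (n choose m)"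
        using m by simp
      also note many
      finally have "K * (n choose (m - 1)) < card \<G>" by (metis of_nat_less_iff of_nat_mult)
      thus ?thesis unfolding card\<C> by (simp add: mult.commute)
    qed
    ultimately obtain c where c: "t < card {M \<in> \<G>. code M = c}"
      using large_fibre[OF \<open>finite \<G>\<close> \<open>finite \<C>\<close>] by blast
    then obtain \<F> where \<F>: "\<F> \<subseteq> {M \<in> \<G>. code M = c}" "card \<F> = t"
      by (meson less_imp_le obtain_subset_with_card_n)
    obtain M0 where M0: "M0 \<in> \<G>" "code M0 = c"
      using c by (metis (mono_tags, lifting) card.empty empty_Collect_eq less_nat_zero_code)
    have inj: "inj_on x \<F>"
    proof (rule inj_onI)
      fix M M' assume M: "M \<in> \<F>" "M' \<in> \<F>" "x M = x M'"
      hence "M - {x M} = M' - {x M'}" using \<F>(1) by (auto simp: code_def)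
      moreover have "M \<in> \<G>" "M' \<in> \<G>" using M \<F>(1) by auto
      ultimately show "M = M'" using xM M(3) by (metis insert_Diff)
    qed
    \<comment> \<open>All members of the fibre agree with \<open>M0\<close> on the other parts, so \<open>M0\<close> supplies those parts.\<close>
    define A' where "A' = (A M0)(i := x ` \<F>)"
    have same: "A M j = A M0 j" if "M \<in> \<F>" "j < r" "j \<noteq> i" for M j
    proof -
      have "code M = code M0" using that(1) \<F>(1) M0(2) by auto
      hence "restrict (A M) J = restrict (A M0) J" by (simp add: code_def)
      thus ?thesis using that(2,3) by (metis DiffI J_def lessThan_iff restrict_apply' singletonD)
    qed
    have sub: "M \<subseteq> V" if "M \<in> \<G>" for M using that by (auto simp: \<G>_def nsets_def)
    have new: "{x M, y} \<in> E" if "M \<in> \<F>" "j < r" "j \<noteq> i" "y \<in> A M0 j" for M j y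
      using cross[of M i j "x M" y] that \<F>(1) x \<open>i < r\<close> same[OF that(1-3)] by auto
    show "multipartite_in r (s(i := t)) V E"
      unfolding multipartite_in_def
    proof (intro exI[of _ A'] conjI allI impI ballI)
      fix j assume j: "j < r"
      show "A' j \<subseteq> V"
      proof (cases "j = i")
        case True
        thus ?thesis using \<F>(1) xM sub by (fastforce simp: A'_def)
      next
        case False
        thus ?thesis using A(1)[OF M0(1) j] sub[OF M0(1)] by (auto simp: A'_def)
      qed
      show "card (A' j) = (s(i := t)) j"
        using A(2)[OF M0(1) j] card_image[OF inj] \<F>(2) by (auto simp: A'_def)
    next
      fix j k u v assume jk: "j < r" "k < r" "j \<noteq> k" "u \<in> A' j" "v \<in> A' k"
      consider "j = i" | "k = i" | "j \<noteq> i" "k \<noteq> i" by blast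
      thus "{u, v} \<in> E"
      proof cases
        case 1
        thus ?thesis using jk new by (auto simp: A'_def)
      next
        case 2
        hence "{v, u} \<in> E" using jk new by (auto simp: A'_def)
        thus ?thesis by (simp add: insert_commute)
      next
        case 3
        thus ?thesis using jk cross[OF M0(1)] by (auto simp: A'_def)
      qed
    qed
  qed
qed

lemma blow_up_all_parts:
  assumes "forced_above a (multipartite_in r (\<lambda>_. 1) :: 'a set \<Rightarrow> 'a set set \<Rightarrow> bool)" and "a \<ge> 0"
  shows "forced_above a (multipartite_in r (\<lambda>_. t) :: 'a set \<Rightarrow> 'a set set \<Rightarrow> bool)"
proof -
  let ?s = "\<lambda>k i. if i < k then t else (1::nat)"
  have "forced_above a (multipartite_in r (?s k) :: 'a set \<Rightarrow> 'a set set \<Rightarrow> bool)" if "k \<le> r" for k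
    using that
  proof (induction k)
    case 0
    thus ?case using assms(1) by simp
  next
    case (Suc k)
    have "forced_above a (multipartite_in r ((?s k)(k := t)) :: 'a set \<Rightarrow> 'a set set \<Rightarrow> bool)"
      by (rule blow_up_one_part) (use Suc \<open>a \<ge> 0\<close> in auto)
    also have "(?s k)(k := t) = ?s (Suc k)" by (auto simp: fun_eq_iff less_Suc_eq)
    finally show ?case .
  qed
  hence "forced_above a (multipartite_in r (?s r) :: 'a set \<Rightarrow> 'a set set \<Rightarrow> bool)" by simp
  also have "multipartite_in r (?s r) = (multipartite_in r (\<lambda>_. t) :: 'a set \<Rightarrow> 'a set set \<Rightarrow> bool)"
    by (rule multipartite_in_cong) simp
  finally show ?thesis .
qed

section \<open>Turan numbers and the Erdos--Stone theorem\<close>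

lemma ex_range_finite:
  "finite {card (edges G) | G :: nat ugraph.
     simple_graph G \<and> verts G = {..<n} \<and> copies H G = {}}"
proof (rule finite_subset)
  show "{card (edges G) | G :: nat ugraph. simple_graph G \<and> verts G = {..<n} \<and> copies H G = {}}
    \<subseteq> card ` Pow (nsets {..<n} 2)"
    by (auto simp: simple_graph_def)
qed (simp add: finite_imp_finite_nsets)

lemma ex_ge:
  assumes "E \<subseteq> nsets {..<n} 2" "copies H ({..<n}, E) = {}"
  shows "card E \<le> ex n H"
  unfolding ex_def
  by (rule Max_ge[OF ex_range_finite])
    (use assms in \<open>auto simp: simple_graph_def intro!: exI[of _ "{..<n}"] exI[of _ E]\<close>)

lemma clique_free_iff:
  "copies (complete_graph r) (V, E) = {} \<longleftrightarrow>
     \<not> (\<exists>W\<subseteq>V. finite W \<and> card W = r \<and> nsets W 2 \<subseteq> E)"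
  by (auto simp: copies_complete_graph)

lemma ex_attained:
  assumes "r \<ge> 2"
  shows "\<exists>E. E \<subseteq> nsets {..<n} 2 \<and> copies (complete_graph r) ({..<n}, E) = {} \<and>
    card E = ex n (complete_graph r)"
proof -
  let ?S = "{card (edges G) | G :: nat ugraph.
     simple_graph G \<and> verts G = {..<n} \<and> copies (complete_graph r) G = {}}"
  have "nsets W 2 \<noteq> {}" if "card W = r" for W :: "nat set"
    using card_nsets[of W 2] that assms by (metis card.empty zero_less_binomial less_numeral_extra(3))
  hence "copies (complete_graph r) ({..<n}, {} :: nat set set) = {}"
    unfolding clique_free_iff by blast
  hence "card ({} :: nat set set) \<in> ?S"
    by (intro CollectI exI[of _ "({..<n}, {})"]) (simp add: simple_graph_def)
  hence "ex n (complete_graph r) \<in> ?S"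
    unfolding ex_def by (intro Max_in ex_range_finite) blast
  then obtain G :: "nat ugraph" where "simple_graph G" "verts G = {..<n}"
    "copies (complete_graph r) G = {}" "card (edges G) = ex n (complete_graph r)"
    by force
  moreover from this have "G = ({..<n}, edges G)" by (simp add: prod_eq_iff)
  ultimately show ?thesis unfolding simple_graph_def by metis
qed

text \<open>
  The Turan number is defined on the vertex set \<open>{..<m}\<close>; a bijection carries it to any set of \<open>m\<close>
  vertices.
\<close>

lemma clique_if_more_than_ex:
  assumes M: "finite M" and E: "E \<subseteq> nsets M 2"
    and many: "ex (card M) (complete_graph r) < card E"
  shows "\<exists>W\<subseteq>M. card W = r \<and> nsets W 2 \<subseteq> E"
proof -
  obtain h where h: "bij_betw h M {..<card M}"
    using ex_bij_betw_finite_nat[OF M] by (auto simp: lessThan_atLeast0)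
  let ?F = "(\<lambda>e. h ` e) ` E"
  have "bij_betw (\<lambda>e. h ` e) (nsets M 2) (nsets {..<card M} 2)"
    by (rule bij_betw_nsets[OF h])
  hence inj: "inj_on (\<lambda>e. h ` e) (nsets M 2)" and "?F \<subseteq> nsets {..<card M} 2"
    using E by (auto simp: bij_betw_def)
  moreover have "card ?F = card E" by (rule card_image[OF inj_on_subset[OF inj E]])
  ultimately have "copies (complete_graph r) ({..<card M}, ?F) \<noteq> {}"
    using many ex_ge[of ?F "card M" "complete_graph r"] by fastforce
  then obtain U where U: "U \<subseteq> {..<card M}" "card U = r" "nsets U 2 \<subseteq> ?F"
    unfolding clique_free_iff by blast
  define W where "W = {x \<in> M. h x \<in> U}"
  have img: "h ` W = U" using U(1) h by (auto simp: W_def bij_betw_def)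
  have hW: "bij_betw h W U"
    unfolding bij_betw_def
    using img h by (auto simp: W_def bij_betw_def intro: inj_on_subset)
  have "nsets W 2 \<subseteq> E"
  proof
    fix e assume e: "e \<in> nsets W 2"
    have "h ` e \<in> nsets U 2" using bij_betw_nsets[OF hW, of 2] e by (auto simp: bij_betw_def)
    then obtain e' where e': "e' \<in> E" "h ` e = h ` e'" using U(3) by blast
    have "e \<in> nsets M 2" using e by (auto simp: nsets_def W_def)
    hence "e = e'" using inj e' E by (auto dest: inj_onD)
    thus "e \<in> E" using e' by simp
  qed
  thus ?thesis using bij_betw_same_card[OF hW] U(2) by (intro exI[of _ W]) (auto simp: W_def)
qed

lemma clique_imp_multipartite:
  assumes "W \<subseteq> V" "finite W" "card W = r" "nsets W 2 \<subseteq> E"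
  shows "multipartite_in r (\<lambda>_. 1) V E"
proof -
  obtain h where h: "bij_betw h {..<r} W"
    using ex_bij_betw_nat_finite[OF assms(2)] assms(3) by (auto simp: lessThan_atLeast0)
  have "{h i, h j} \<in> E" if "i < r" "j < r" "i \<noteq> j" for i j
  proof -
    have "h i \<in> W" "h j \<in> W" "h i \<noteq> h j"
      using h that by (auto simp: bij_betw_def inj_on_def)
    hence "{h i, h j} \<in> nsets W 2" by (simp add: nsets_def)
    thus ?thesis using assms(4) by blast
  qed
  moreover have "h i \<in> V" if "i < r" for i using h that assms(1) by (auto simp: bij_betw_def)
  ultimately show ?thesis
    unfolding multipartite_in_def by (intro exI[of _ "\<lambda>i. {h i}"]) auto
qed

text \<open>
  The Turan density of \<open>K\<^sub>r\<close>. It is usually defined as a limit; the infimum has the advantage of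
  bounding the density of \<open>ex n (complete_graph r)\<close> from below for every \<open>n\<close>.
\<close>

definition turan_density :: "nat \<Rightarrow> real" where
  "turan_density r = (INF m\<in>{2..}. real (ex m (complete_graph r)) / real (m choose 2))"

lemma turan_density_bdd:
  "bdd_below ((\<lambda>m. real (ex m (complete_graph r)) / real (m choose 2)) ` {2..})"
  by (rule bdd_belowI2[of _ 0]) auto

lemma turan_density_nonneg: "turan_density r \<ge> 0"
  unfolding turan_density_def by (rule cINF_greatest) auto

lemma turan_density_le_ex:
  "turan_density r * real (n choose 2) \<le> real (ex n (complete_graph r))"
proof (cases "n \<ge> 2")
  case True
  hence "turan_density r \<le> real (ex n (complete_graph r)) / real (n choose 2)"
    unfolding turan_density_def by (intro cINF_lower[OF turan_density_bdd]) auto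
  thus ?thesis using True by (simp add: pos_le_divide_eq)
qed (simp add: binomial_eq_0)

text \<open>
  By definition of the infimum some \<open>m\<close> has extremal density below \<open>turan_density r + \<epsilon> / 2\<close>. A denser
  graph has an \<open>m\<close>-set whose density is at least that number, by averaging, and it contains a clique.
\<close>

lemma clique_forced_above_turan_density:
  "forced_above (turan_density r) (multipartite_in r (\<lambda>_. 1))"
  unfolding forced_above_def
proof (intro allI impI)
  fix \<epsilon> :: real assume "\<epsilon> > 0"
  hence "turan_density r < turan_density r + \<epsilon> / 2" by simp
  then obtain m where m: "m \<ge> 2"
    "real (ex m (complete_graph r)) / real (m choose 2) < turan_density r + \<epsilon> / 2"
    unfolding turan_density_def by (subst (asm) cINF_less_iff[OF _ turan_density_bdd]) auto
  show "\<exists>N. \<forall>V E. finite (V :: 'a set) \<longrightarrow> N \<le> card V \<longrightarrow> E \<subseteq> nsets V 2 \<longrightarrow>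
     (turan_density r + \<epsilon>) * real (card V choose 2) \<le> real (card E) \<longrightarrow>
     multipartite_in r (\<lambda>_. 1) V E"
  proof (intro exI[of _ m] allI impI)
    fix V :: "'a set" and E
    assume V: "finite V" "m \<le> card V" "E \<subseteq> nsets V 2"
      and dense: "(turan_density r + \<epsilon>) * real (card V choose 2) \<le> real (card E)"
    let ?\<G> = "{M \<in> nsets V m.
      (turan_density r + \<epsilon> / 2) * real (m choose 2) \<le> real (card (E \<inter> nsets M 2))}"
    have "0 < \<epsilon> / 2 * real (card V choose m)" using \<open>\<epsilon> > 0\<close> V(2) by simp
    also have "\<dots> \<le> real (card ?\<G>)"
      by (rule dense_subsets[OF V(1) m(1) V(2,3)])
        (use dense \<open>\<epsilon> > 0\<close> turan_density_nonneg[of r] in \<open>auto simp: add.commute add.assoc\<close>)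
    finally have "?\<G> \<noteq> {}" by (metis card.empty of_nat_0 less_irrefl)
    then obtain M where M: "M \<subseteq> V" "finite M" "card M = m"
      "(turan_density r + \<epsilon> / 2) * real (m choose 2) \<le> real (card (E \<inter> nsets M 2))"
      by (auto simp: nsets_def)
    have "real (ex m (complete_graph r)) < (turan_density r + \<epsilon> / 2) * real (m choose 2)"
      using m by (simp add: pos_divide_less_eq)
    with M(4) have "ex (card M) (complete_graph r) < card (E \<inter> nsets M 2)"
      using M(3) by simp
    from clique_if_more_than_ex[OF M(2) _ this] obtain W where
      "W \<subseteq> M" "card W = r" "nsets W 2 \<subseteq> E \<inter> nsets M 2" by auto
    thus "multipartite_in r (\<lambda>_. 1) V E"
      using M by (intro clique_imp_multipartite) (auto intro: finite_subset)
  qed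
qed

text \<open>
  The density of \<open>ex n (complete_graph r)\<close> is never below \<open>turan_density r\<close>, so \<open>\<epsilon> * n\<^sup>2\<close> edges beyond
  the Turan number lift a graph above the threshold of \<open>K\<^sub>r\<close>, which is also that of its blow-ups.
\<close>

lemma erdos_stone:
  assumes "\<epsilon> > 0"
  shows "\<exists>N. \<forall>n\<ge>N. \<forall>E \<subseteq> nsets {..<n} 2.
    real (ex n (complete_graph r)) + \<epsilon> * (real n)\<^sup>2 \<le> real (card E) \<longrightarrow>
    multipartite_in r (\<lambda>_. t) {..<n} E"
proof -
  have "forced_above (turan_density r)
      (multipartite_in r (\<lambda>_. t) :: nat set \<Rightarrow> nat set set \<Rightarrow> bool)"
    by (rule blow_up_all_parts[OF clique_forced_above_turan_density turan_density_nonneg])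
  from this[unfolded forced_above_def, rule_format, OF assms] obtain N where
    N: "\<forall>V E. finite (V :: nat set) \<longrightarrow> N \<le> card V \<longrightarrow> E \<subseteq> nsets V 2 \<longrightarrow>
     (turan_density r + \<epsilon>) * real (card V choose 2) \<le> real (card E) \<longrightarrow>
     multipartite_in r (\<lambda>_. t) V E" ..
  have le: "(turan_density r + \<epsilon>) * real (n choose 2) \<le> real (ex n (complete_graph r)) + \<epsilon> * (real n)\<^sup>2" for n
  proof -
    have "n choose 2 \<le> n ^ 2"
      by (cases "2 \<le> n") (auto intro: binomial_le_pow simp: binomial_eq_0)
    hence "real (n choose 2) \<le> (real n)\<^sup>2" by (metis of_nat_le_iff of_nat_power)
    hence "\<epsilon> * real (n choose 2) \<le> \<epsilon> * (real n)\<^sup>2" using assms by (intro mult_left_mono) auto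
    thus ?thesis using turan_density_le_ex[of r n] by (simp add: algebra_simps)
  qed
  show ?thesis
  proof (intro exI[of _ N] allI impI)
    fix n E
    assume "N \<le> n" "E \<subseteq> nsets {..<n} 2"
      "real (ex n (complete_graph r)) + \<epsilon> * (real n)\<^sup>2 \<le> real (card E)"
    thus "multipartite_in r (\<lambda>_. t) {..<n} E"
      using le[of n] by (intro N[rule_format]) auto
  qed
qed

section \<open>Proper cliques and wheels in rainbow multipartite graphs\<close>

text \<open>
  If \<open>\<chi>\<close> is injective on \<open>E\<close>, at most one edge of \<open>E\<close> has the colour of the pair \<open>P\<close>. A set that
  contains \<open>P\<close> and avoids \<open>clash \<chi> E P\<close> spans no edge of \<open>E\<close> other than \<open>P\<close> in that colour.
\<close>

definition clash :: "('a set \<Rightarrow> 'c) \<Rightarrow> 'a set set \<Rightarrow> 'a set \<Rightarrow> 'a set" where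
  "clash \<chi> E P = \<Union>{e \<in> E. \<chi> e = \<chi> P} - P"

lemma card_clash:
  assumes "inj_on \<chi> E" "E \<subseteq> nsets V 2"
  shows "finite (clash \<chi> E P)" "card (clash \<chi> E P) \<le> 2"
proof -
  have "finite (clash \<chi> E P) \<and> card (clash \<chi> E P) \<le> 2"
  proof (cases "\<exists>e\<in>E. \<chi> e = \<chi> P")
    case True
    then obtain e where e: "e \<in> E" "\<chi> e = \<chi> P" by blast
    hence "{d \<in> E. \<chi> d = \<chi> P} = {e}" using assms(1) by (auto simp: inj_on_def)
    hence "clash \<chi> E P \<subseteq> e" by (auto simp: clash_def)
    moreover have "finite e" "card e = 2" using e(1) assms(2) by (auto simp: nsets_def)
    ultimately show ?thesis using card_mono finite_subset by metis
  next
    case False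
    hence "clash \<chi> E P = {}" by (auto simp: clash_def)
    thus ?thesis by simp
  qed
  thus "finite (clash \<chi> E P)" "card (clash \<chi> E P) \<le> 2" by auto
qed

text \<open>
  A pair \<open>P i\<close> may clash with a pair chosen earlier or later, so a single greedy pass does not work.
  In the induction all parts but the last are cut down to a bounded size, and the last one is so large
  that it has room for a pair \<open>P0\<close> outside \<open>B Q\<close> for all pairs \<open>Q\<close> in the other parts; after that the
  at most two vertices of \<open>B P0\<close> are deleted from each of the other parts.
\<close>

lemma conflict_free_pairs:
  "\<exists>t. \<forall>(A :: nat \<Rightarrow> 'a set) (B :: 'a set \<Rightarrow> 'a set). (\<forall>i<r. finite (A i) \<and> t \<le> card (A i)) \<longrightarrow>
     (\<forall>P. finite (B P) \<and> card (B P) \<le> 2) \<longrightarrow>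
     (\<exists>P. (\<forall>i<r. P i \<subseteq> A i \<and> card (P i) = 2) \<and>
          (\<forall>i<r. \<forall>j<r. i \<noteq> j \<longrightarrow> B (P i) \<inter> P j = {}))"
proof (induction r)
  case 0
  thus ?case by simp
next
  case (Suc r)
  then obtain t where t: "\<forall>(A :: nat \<Rightarrow> 'a set) (B :: 'a set \<Rightarrow> 'a set). (\<forall>i<r. finite (A i) \<and> t \<le> card (A i)) \<longrightarrow>
     (\<forall>P. finite (B P) \<and> card (B P) \<le> 2) \<longrightarrow>
     (\<exists>P. (\<forall>i<r. P i \<subseteq> A i \<and> card (P i) = 2) \<and>
          (\<forall>i<r. \<forall>j<r. i \<noteq> j \<longrightarrow> B (P i) \<inter> P j = {}))" ..
  \<comment> \<open>Each of the other \<open>r\<close> parts is cut down to \<open>t + 2\<close> vertices; \<open>K\<close> bounds the number of vertices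
    that their pairs forbid, and deleting \<open>B P0\<close> leaves \<open>t\<close> vertices per part.\<close>
  define K where "K = ((r * (t + 2)) choose 2) * 2"
  show ?case
  proof (intro exI[of _ "t + 2 + K"] allI impI)
    fix A :: "nat \<Rightarrow> 'a set" and B :: "'a set \<Rightarrow> 'a set"
    assume A: "\<forall>i<Suc r. finite (A i) \<and> t + 2 + K \<le> card (A i)"
      and B: "\<forall>P. finite (B P) \<and> card (B P) \<le> 2"
    have "\<forall>i\<in>{..<r}. \<exists>C. C \<subseteq> A i \<and> card C = t + 2"
    proof
      fix i assume "i \<in> {..<r}"
      hence "t + 2 \<le> card (A i)" using A by (auto intro: order_trans[of _ "t + 2 + K"])
      thus "\<exists>C. C \<subseteq> A i \<and> card C = t + 2" using obtain_subset_with_card_n by metis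
    qed
    from bchoice[OF this] obtain C where "\<forall>i\<in>{..<r}. C i \<subseteq> A i \<and> card (C i) = t + 2" ..
    hence C: "C i \<subseteq> A i" "card (C i) = t + 2" if "i < r" for i using that by auto
    have finC: "finite (C i)" if "i < r" for i using C[OF that] card.infinite by fastforce
    define X where "X = (\<Union>i<r. C i)"
    define U where "U = (\<Union>Q\<in>nsets X 2. B Q)"
    have X: "finite X" using finC by (auto simp: X_def)
    have "card X \<le> (\<Sum>i<r. card (C i))" unfolding X_def by (rule card_UN_le) simp
    also have "\<dots> = r * (t + 2)" using C(2) by simp
    finally have cardX: "card X \<le> r * (t + 2)" .
    have finX2: "finite (nsets X 2)" using X by (simp add: finite_imp_finite_nsets)
    hence U: "finite U" using B by (auto simp: U_def)
    have "card U \<le> (\<Sum>Q\<in>nsets X 2. card (B Q))" unfolding U_def by (rule card_UN_le[OF finX2])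
    also have "\<dots> \<le> card (nsets X 2) * 2" using sum_bounded_above[of "nsets X 2" "\<lambda>Q. card (B Q)" 2] B by simp
    also have "\<dots> \<le> K" using binomial_right_mono[OF cardX, of 2] by (simp add: K_def card_nsets)
    finally have "card U \<le> K" .
    have "t + 2 + K \<le> card (A r)" using A by simp
    hence "2 \<le> card (A r - U)" using diff_card_le_card_Diff[OF U, of "A r"] \<open>card U \<le> K\<close> by linarith
    then obtain P0 where P0: "P0 \<subseteq> A r - U" "card P0 = 2" by (meson obtain_subset_with_card_n)
    have still_large: "finite (C i - B P0) \<and> t \<le> card (C i - B P0)" if "i < r" for i
    proof -
      have "card (C i) - card (B P0) \<le> card (C i - B P0)"
        by (rule diff_card_le_card_Diff) (use B in blast)
      moreover have "card (B P0) \<le> 2" using B by blast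
      ultimately show ?thesis using C(2)[OF that] finC[OF that] by simp
    qed
    have "\<exists>P. (\<forall>i<r. P i \<subseteq> C i - B P0 \<and> card (P i) = 2) \<and>
        (\<forall>i<r. \<forall>j<r. i \<noteq> j \<longrightarrow> B (P i) \<inter> P j = {})"
    proof (rule t[THEN spec, of "\<lambda>i. C i - B P0", THEN spec, of B, THEN mp, THEN mp, OF _ B])
      show "\<forall>i<r. finite (C i - B P0) \<and> t \<le> card (C i - B P0)" using still_large by blast
    qed
    then obtain P where *: "\<forall>i<r. P i \<subseteq> C i - B P0 \<and> card (P i) = 2"
      "\<forall>i<r. \<forall>j<r. i \<noteq> j \<longrightarrow> B (P i) \<inter> P j = {}" by (elim exE conjE)
    have P: "P i \<subseteq> C i - B P0 \<and> card (P i) = 2" if "i < r" for i using *(1) that by blast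
    have PP: "B (P i) \<inter> P j = {}" if "i < r" "j < r" "i \<noteq> j" for i j using *(2) that by blast
    have to_P0: "B (P i) \<inter> P0 = {}" if "i < r" for i
    proof -
      have "P i \<subseteq> X" using P[OF that] that by (auto simp: X_def)
      moreover have "finite (P i)" using P[OF that] by (intro card_ge_0_finite) simp
      ultimately have "P i \<in> nsets X 2" using P[OF that] by (simp add: nsets_def)
      thus ?thesis using P0(1) by (auto simp: U_def)
    qed
    have from_P0: "B P0 \<inter> P i = {}" if "i < r" for i using P[OF that] by blast
    show "\<exists>P. (\<forall>i<Suc r. P i \<subseteq> A i \<and> card (P i) = 2) \<and>
          (\<forall>i<Suc r. \<forall>j<Suc r. i \<noteq> j \<longrightarrow> B (P i) \<inter> P j = {})"
    proof (intro exI[of _ "P(r := P0)"] conjI allI impI)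
      fix i assume "i < Suc r"
      thus "(P(r := P0)) i \<subseteq> A i" "card ((P(r := P0)) i) = 2"
        using P[of i] C(1)[of i] P0 by (auto simp: less_Suc_eq)
    next
      fix i j assume "i < Suc r" "j < Suc r" "i \<noteq> j"
      thus "B ((P(r := P0)) i) \<inter> (P(r := P0)) j = {}"
        using to_P0[of i] from_P0[of j] PP[of i j] by (auto simp: less_Suc_eq)
    qed
  qed
qed

text \<open>
  With the pairs of \<open>conflict_free_pairs\<close> for \<open>B = clash \<chi> E\<close>, the only edges of their union outside
  \<open>E\<close> are the disjoint pairs themselves, and no edge of \<open>E\<close> inside the union has the colour of a pair.
\<close>

lemma proper_clique_in_rainbow_multipartite:
  "\<exists>t. \<forall>(V :: 'a set) E \<chi>. finite V \<longrightarrow> E \<subseteq> nsets V 2 \<longrightarrow> inj_on \<chi> E \<longrightarrow>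
     multipartite_in r (\<lambda>_. t) V E \<longrightarrow>
     (\<exists>W\<subseteq>V. card W = 2 * r \<and> proper_on (\<chi> :: 'a set \<Rightarrow> 'c) (nsets W 2))"
proof -
  from conflict_free_pairs[of r] obtain t where
    t: "\<forall>(A :: nat \<Rightarrow> 'a set) (B :: 'a set \<Rightarrow> 'a set). (\<forall>i<r. finite (A i) \<and> t \<le> card (A i)) \<longrightarrow>
     (\<forall>P. finite (B P) \<and> card (B P) \<le> 2) \<longrightarrow>
     (\<exists>P. (\<forall>i<r. P i \<subseteq> A i \<and> card (P i) = 2) \<and>
          (\<forall>i<r. \<forall>j<r. i \<noteq> j \<longrightarrow> B (P i) \<inter> P j = {}))" ..
  show ?thesis
  proof (intro exI[of _ t] allI impI)
    fix V :: "'a set" and E and \<chi> :: "'a set \<Rightarrow> 'c"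
    assume V: "finite V" and E: "E \<subseteq> nsets V 2" and inj: "inj_on \<chi> E"
      and "multipartite_in r (\<lambda>_. t) V E"
    then obtain A where A: "\<forall>i<r. A i \<subseteq> V \<and> card (A i) = t"
      and cross: "\<forall>i<r. \<forall>j<r. i \<noteq> j \<longrightarrow> (\<forall>x\<in>A i. \<forall>y\<in>A j. {x, y} \<in> E)"
      unfolding multipartite_in_def by blast
    have "\<forall>i<r. finite (A i) \<and> t \<le> card (A i)" using A V by (metis finite_subset order_refl)
    moreover have "\<forall>P. finite (clash \<chi> E P) \<and> card (clash \<chi> E P) \<le> 2"
      using card_clash[OF inj E] by blast
    ultimately have "\<exists>P. (\<forall>i<r. P i \<subseteq> A i \<and> card (P i) = 2) \<and>
        (\<forall>i<r. \<forall>j<r. i \<noteq> j \<longrightarrow> clash \<chi> E (P i) \<inter> P j = {})"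
      by (rule t[THEN spec, of A, THEN spec, of "clash \<chi> E", THEN mp, THEN mp])
    then obtain P where *: "\<forall>i<r. P i \<subseteq> A i \<and> card (P i) = 2"
      "\<forall>i<r. \<forall>j<r. i \<noteq> j \<longrightarrow> clash \<chi> E (P i) \<inter> P j = {}" by (elim exE conjE)
    have P: "P i \<subseteq> A i \<and> card (P i) = 2" if "i < r" for i using *(1) that by blast
    have PP: "clash \<chi> E (P i) \<inter> P j = {}" if "i < r" "j < r" "i \<noteq> j" for i j
      using *(2) that by blast
    have disjA: "A i \<inter> A j = {}" if "i < r" "j < r" "i \<noteq> j" for i j
    proof (rule ccontr)
      assume "A i \<inter> A j \<noteq> {}"
      then obtain x where "x \<in> A i" "x \<in> A j" by blast
      hence "{x, x} \<in> E" using cross that by blast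
      thus False using E by (auto simp: nsets_def)
    qed
    define W where "W = (\<Union>i<r. P i)"
    have finP: "finite (P i)" if "i < r" for i using P[OF that] by (intro card_ge_0_finite) simp
    have disjP: "P i \<inter> P j = {}" if "i < r" "j < r" "i \<noteq> j" for i j
      using disjA[OF that] P that(1,2) by blast
    have "card W = (\<Sum>i<r. card (P i))"
      unfolding W_def by (rule card_UN_disjoint) (use finP disjP in auto)
    also have "\<dots> = 2 * r" using P by simp
    finally have "card W = 2 * r" .
    moreover have "W \<subseteq> V" using P A by (fastforce simp: W_def)
    moreover have "proper_on \<chi> (nsets W 2)"
    proof -
      have kind: "e \<in> E \<or> (\<exists>i<r. e = P i)" if e: "e \<in> nsets W 2" for e
      proof -
        obtain x y where xy: "e = {x, y}" "x \<noteq> y" "x \<in> W" "y \<in> W"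
          using e by (auto simp: nsets_def card_2_iff)
        then obtain i j where ij: "i < r" "j < r" "x \<in> P i" "y \<in> P j" by (auto simp: W_def)
        show ?thesis
        proof (cases "i = j")
          case True
          hence "e \<subseteq> P i" "card e = card (P i)" using ij xy P by auto
          hence "e = P i" using finP ij(1) by (simp add: card_subset_eq)
          thus ?thesis using ij by blast
        next
          case False
          thus ?thesis using ij xy cross P by blast
        qed
      qed
      have mixed: "\<chi> e \<noteq> \<chi> (P i)" if e: "e \<in> nsets W 2" "e \<in> E" "i < r" "e \<noteq> P i" for e i
      proof
        assume eq: "\<chi> e = \<chi> (P i)"
        have "card e = card (P i)" using e P by (simp add: nsets_def)
        hence "\<not> e \<subseteq> P i" using card_subset_eq[of "P i" e] finP e by blast
        then obtain y where y: "y \<in> e" "y \<notin> P i" by blast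
        then obtain j where j: "j < r" "y \<in> P j" using e by (auto simp: nsets_def W_def)
        have "y \<in> clash \<chi> E (P i)" using y e eq by (auto simp: clash_def)
        moreover have "i \<noteq> j" using y j by blast
        ultimately show False using PP[OF \<open>i < r\<close> j(1)] j(2) by blast
      qed
      show ?thesis
        unfolding proper_on_def
      proof (intro ballI impI)
        fix e e' assume e: "e \<in> nsets W 2" "e' \<in> nsets W 2" "e \<noteq> e' \<and> \<chi> e = \<chi> e'"
        show "e \<inter> e' = {}"
        proof (cases "e \<in> E \<or> e' \<in> E")
          case True
          have "\<not> (e \<in> E \<and> e' \<in> E)" using inj e(3) by (auto simp: inj_on_def)
          thus ?thesis using True kind[OF e(1)] kind[OF e(2)] mixed[OF e(1)] mixed[OF e(2)] e(3)
            by metis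
        next
          case False
          thus ?thesis using kind[OF e(1)] kind[OF e(2)] disjP e(3) by metis
        qed
      qed
    qed
    ultimately show "\<exists>W\<subseteq>V. card W = 2 * r \<and> proper_on \<chi> (nsets W 2)" by blast
  qed
qed

lemma edges_wheel_graph:
  "edges (wheel_graph k) = {{Inl i, Inl (Suc i mod k)} | i. i < k} \<union> {{Inl i, Inr 0} | i. i < k}"
proof -
  have "nsets {..<1::nat} 2 = {}" by (simp add: nsets_eq_empty_iff)
  moreover have "(\<lambda>e. Inl ` e :: (nat + nat) set) ` {{i, Suc i mod k} | i. i < k} = {{Inl i, Inl (Suc i mod k)} | i. i < k}"
    unfolding setcompr_eq_image image_image by simp
  ultimately show ?thesis
    by (simp add: wheel_graph_def graph_join_def cycle_graph_def complete_graph_def)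
qed

lemma verts_wheel_graph: "verts (wheel_graph k) = Inl ` {..<k} \<union> {Inr 0}"
  by (simp add: wheel_graph_def graph_join_def cycle_graph_def complete_graph_def lessThan_Suc)

lemma wheel_copyI:
  assumes f: "inj_on f {..<k}" "f ` {..<k} \<subseteq> {..<n}" and c: "c < n" "c \<notin> f ` {..<k}" and "k \<ge> 2"
  shows "(f ` {..<k} \<union> {c}, {{f i, f (Suc i mod k)} | i. i < k} \<union> {{f i, c} | i. i < k})
    \<in> copies (wheel_graph k) (complete_graph n)"
proof -
  let ?\<phi> = "case_sum f (\<lambda>_ :: nat. c)"
  have ne: "f i \<noteq> f (Suc i mod k)" if "i < k" for i
  proof
    assume "f i = f (Suc i mod k)"
    hence "i = Suc i mod k" using f(1) that by (auto simp: inj_on_def)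
    thus False using that \<open>k \<ge> 2\<close> by (cases "Suc i = k") auto
  qed
  have "inj_on ?\<phi> (verts (wheel_graph k))"
    using f c by (auto simp: verts_wheel_graph inj_on_def)
  moreover have "?\<phi> ` verts (wheel_graph k) = f ` {..<k} \<union> {c}"
    by (auto simp: verts_wheel_graph image_Un image_image)
  moreover have "(\<lambda>e. ?\<phi> ` e) ` edges (wheel_graph k)
      = {{f i, f (Suc i mod k)} | i. i < k} \<union> {{f i, c} | i. i < k}"
    unfolding edges_wheel_graph image_Un setcompr_eq_image image_image by simp
  ultimately have "graph_iso (wheel_graph k)
      (f ` {..<k} \<union> {c}, {{f i, f (Suc i mod k)} | i. i < k} \<union> {{f i, c} | i. i < k})"
    unfolding graph_iso_def by (intro exI[of _ ?\<phi>]) (simp add: bij_betw_def)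
  moreover have "{f i, f (Suc i mod k)} \<in> nsets {..<n} 2" if "i < k" for i
  proof -
    have "Suc i mod k < k" using that by simp
    hence "f i \<in> f ` {..<k}" "f (Suc i mod k) \<in> f ` {..<k}" using that by blast+
    hence "f i < n" "f (Suc i mod k) < n" using f(2) by blast+
    thus ?thesis using ne[OF that] by (simp add: nsets_def)
  qed
  moreover have "{f i, c} \<in> nsets {..<n} 2" if "i < k" for i
  proof -
    have "f i \<noteq> c" using c(2) that by blast
    thus ?thesis using c(1) f(2) that by (auto simp: nsets_def)
  qed
  ultimately show ?thesis using f c by (auto simp: copies_def complete_graph_def)
qed

text \<open>
  The hub lies in part \<open>2\<close> and the rim alternates between parts \<open>0\<close> and \<open>1\<close>. For odd \<open>k\<close> the rim closes
  up with an edge \<open>P\<close> inside part \<open>0\<close>; all vertices avoid \<open>clash \<chi> E P\<close>, so that the whole wheel is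
  rainbow.
\<close>

lemma proper_wheel_in_rainbow_tripartite:
  fixes \<chi> :: "nat set \<Rightarrow> 'c"
  assumes k: "k \<ge> 3" and E: "E \<subseteq> nsets {..<n} 2" and inj: "inj_on \<chi> E"
    and multi: "multipartite_in 3 (\<lambda>_. k + 4) {..<n} E"
  shows "\<exists>S\<in>copies (wheel_graph k) (complete_graph n). proper_on \<chi> (edges S)"
proof -
  obtain A where A: "\<forall>i<3::nat. A i \<subseteq> {..<n} \<and> card (A i) = k + 4"
    and "\<forall>i<3. \<forall>j<3. i \<noteq> j \<longrightarrow> (\<forall>x\<in>A i. \<forall>y\<in>A j. {x, y} \<in> E)"
    using multi unfolding multipartite_in_def by blast
  hence cross: "{x, y} \<in> E" if "i < 3" "j < 3" "i \<noteq> j" "x \<in> A i" "y \<in> A j" for i j x y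
    using that by blast
  have disj: "A i \<inter> A j = {}" if "i < 3" "j < 3" "i \<noteq> j" for i j
  proof (rule ccontr)
    assume "A i \<inter> A j \<noteq> {}"
    then obtain x where "x \<in> A i" "x \<in> A j" by blast
    hence "{x, x} \<in> E" using cross that by metis
    thus False using E by (auto simp: nsets_def)
  qed
  have A': "A i \<subseteq> {..<n}" "card (A i) = k + 4" "finite (A i)" if "i < 3" for i
    using A that finite_subset[of "A i" "{..<n}"] by auto
  \<comment> \<open>Part \<open>0\<close> has to accommodate \<open>k\<close> vertices besides the two of \<open>P\<close> and the at most two of the clash;
    this is the reason for the size \<open>k + 4\<close>.\<close>
  have "2 \<le> card (A 0)" using A'[of 0] by simp
  then obtain P where P: "P \<subseteq> A 0" "card P = 2" by (meson obtain_subset_with_card_n)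
  then obtain p q where pq: "P = {p, q}" "p \<noteq> q" by (auto simp: card_2_iff)
  define B where "B = clash \<chi> E P"
  have B: "finite B" "card B \<le> 2" "B \<inter> P = {}"
    using card_clash[OF inj E] by (auto simp: B_def clash_def)
  have "card (A 0) - card (P \<union> B) \<le> card (A 0 - (P \<union> B))"
    by (rule diff_card_le_card_Diff) (use B pq in auto)
  moreover have "card (P \<union> B) \<le> 4" using card_Un_le[of P B] B P by simp
  ultimately have "k \<le> card (A 0 - (P \<union> B))" using A'[of 0] by simp
  then obtain a where a: "inj_on a {..<k}" "a ` {..<k} \<subseteq> A 0 - (P \<union> B)"
    using card_le_inj[of "{..<k}" "A 0 - (P \<union> B)"] A'[of 0] by auto
  have big: "k + 2 \<le> card (A i - B)" if "i < 3" for i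
    using diff_card_le_card_Diff[OF B(1), of "A i"] B(2) A'[OF that] by linarith
  obtain b where b: "inj_on b {..<k}" "b ` {..<k} \<subseteq> A 1 - B"
    using card_le_inj[of "{..<k}" "A 1 - B"] A'[of 1] big[of 1] by auto
  have "card (A 2 - B) > 0" using big[of 2] by simp
  hence "A 2 - B \<noteq> {}" by (metis card.empty less_irrefl)
  then obtain c where c: "c \<in> A 2" "c \<notin> B" by blast
  define f where "f i = (if i = 0 then p else if i = k - 1 \<and> even i then q
    else if even i then a i else b i)" for i
  have f0: "f i \<in> A 0" "f i \<notin> B" if "i < k" "even i" for i
    using that a(2) P(1) B(3) pq by (auto simp: f_def)
  have f1: "f i \<in> A 1" "f i \<notin> B" if "i < k" "odd i" for i
    using that b(2) by (auto simp: f_def elim!: oddE)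
  have a': "a i \<noteq> p" "a i \<noteq> q" if "i < k" for i using a(2) pq that by auto
  have injf: "inj_on f {..<k}"
  proof (rule inj_onI)
    fix i j assume ij: "i \<in> {..<k}" "j \<in> {..<k}" "f i = f j"
    have par: "even i = even j"
      using f0(1)[of i] f0(1)[of j] f1(1)[of i] f1(1)[of j] disj[of 0 1] ij by auto
    show "i = j"
    proof (cases "even i")
      case True
      thus ?thesis using ij par a' a'[symmetric] pq(2) a(1) k
        by (auto simp: f_def inj_on_def split: if_splits)
    next
      case False
      hence "i \<noteq> 0" "j \<noteq> 0" using par by (metis even_zero)+
      thus ?thesis using ij par False b(1) by (auto simp: f_def inj_on_def)
    qed
  qed
  have f01: "f i \<in> A 0 \<union> A 1" "f i \<notin> B" if "i < k" for i using f0 f1 that by blast+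
  let ?F = "{{f i, f (Suc i mod k)} | i. i < k} \<union> {{f i, c} | i. i < k}"
  have "(f ` {..<k} \<union> {c}, ?F) \<in> copies (wheel_graph k) (complete_graph n)"
  proof (rule wheel_copyI[OF injf])
    show "f ` {..<k} \<subseteq> {..<n}" using f01(1) A'(1)[of 0] A'(1)[of 1] by fastforce
    show "c < n" using c A'(1)[of 2] by auto
    show "c \<notin> f ` {..<k}" using c f01(1) disj[of 0 2] disj[of 1 2] by fastforce
  qed (use k in simp)
  moreover have "proper_on \<chi> ?F"
  proof -
    have rim: "{f i, f (Suc i mod k)} \<in> E \<or> {f i, f (Suc i mod k)} = P" if "i < k" for i
    proof (cases "Suc i = k")
      case True
      show ?thesis
      proof (cases "even i")
        case True
        hence "f i = q" using \<open>Suc i = k\<close> k by (auto simp: f_def)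
        moreover have "f (Suc i mod k) = p" using \<open>Suc i = k\<close> by (simp add: f_def)
        ultimately show ?thesis using pq by auto
      next
        case False
        have "f 0 \<in> A 0" "f i \<in> A 1" using f0[of 0] f1[OF that False] k by auto
        hence "{f i, f 0} \<in> E" using cross[of 1 0] by simp
        thus ?thesis using \<open>Suc i = k\<close> by simp
      qed
    next
      case False
      hence Suc: "Suc i < k" "Suc i mod k = Suc i" using that by auto
      show ?thesis
      proof (cases "even i")
        case True
        hence "{f i, f (Suc i)} \<in> E" using f0(1)[OF that] f1(1)[OF Suc(1)] cross[of 0 1] by simp
        thus ?thesis using Suc by simp
      next
        case False
        hence "{f i, f (Suc i)} \<in> E" using f1(1)[OF that] f0(1)[OF Suc(1)] cross[of 1 0] by simp
        thus ?thesis using Suc by simp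
      qed
    qed
    have hub: "{f i, c} \<in> E" if "i < k" for i using f01(1)[OF that] c cross[of 0 2] cross[of 1 2] by auto
    have kind: "e \<in> E \<or> e = P" if "e \<in> ?F" for e using that rim hub by blast
    have avoid: "e \<inter> B = {}" if "e \<in> ?F" for e
    proof -
      have "Suc i mod k < k" for i using k by simp
      thus ?thesis using that f01(2) c(2) by auto
    qed
    have mixed: "\<chi> e \<noteq> \<chi> P" if e: "e \<in> ?F" "e \<in> E" "e \<noteq> P" for e
    proof
      assume eq: "\<chi> e = \<chi> P"
      have "card e = card P" using e E P by (auto simp: nsets_def)
      hence "\<not> e \<subseteq> P" using card_subset_eq[of P e] pq e by blast
      then obtain y where y: "y \<in> e" "y \<notin> P" by blast
      hence "y \<in> B" using e eq by (auto simp: B_def clash_def)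
      thus False using avoid[OF e(1)] y by blast
    qed
    show ?thesis
      unfolding proper_on_def
    proof (intro ballI impI)
      fix e e' assume e: "e \<in> ?F" "e' \<in> ?F" "e \<noteq> e' \<and> \<chi> e = \<chi> e'"
      have "\<not> (e \<in> E \<and> e' \<in> E)" using inj e(3) by (auto simp: inj_on_def)
      thus "e \<inter> e' = {}"
        using kind[OF e(1)] kind[OF e(2)] mixed[OF e(1)] mixed[OF e(2)] e(3) by metis
    qed
  qed
  ultimately show ?thesis by (intro bexI) auto
qed

section \<open>Turan numbers of the edge and the triangle\<close>

lemma nsets_triangle:
  assumes "x \<noteq> y" "x \<noteq> z" "y \<noteq> z"
  shows "nsets {x, y, z} 2 = {{x, y}, {x, z}, {y, z}}"
proof
  show "nsets {x, y, z} 2 \<subseteq> {{x, y}, {x, z}, {y, z}}"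
  proof
    fix e assume "e \<in> nsets {x, y, z} 2"
    then obtain u v where "e = {u, v}" "u \<noteq> v" "u \<in> {x, y, z}" "v \<in> {x, y, z}"
      by (auto simp: nsets_def card_2_iff)
    thus "e \<in> {{x, y}, {x, z}, {y, z}}" by (elim insertE emptyE) (simp_all add: insert_commute)
  qed
qed (use assms in \<open>simp add: nsets_def\<close>)

text \<open>
  Removing the ends of an edge \<open>{x, y}\<close> from a triangle-free graph on \<open>n\<close> vertices destroys at most
  \<open>n - 1\<close> edges, since every other vertex is adjacent to at most one of \<open>x\<close> and \<open>y\<close>; induction gives
  \<open>(n - 2)\<^sup>2 + 4 * (n - 1) = n\<^sup>2\<close>.
\<close>

lemma mantel:
  assumes "finite V" "E \<subseteq> nsets V 2" "\<not> (\<exists>W\<subseteq>V. card W = 3 \<and> nsets W 2 \<subseteq> E)"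
  shows "4 * card E \<le> (card V)\<^sup>2"
  using assms
proof (induction "card V" arbitrary: V E rule: less_induct)
  case less
  show ?case
  proof (cases "E = {}")
    case False
    then obtain d where "d \<in> E" by blast
    then obtain x y where xy: "{x, y} \<in> E" "x \<noteq> y" "x \<in> V" "y \<in> V"
      using less.prems(2) by (metis nsets2_E subsetD)
    define V' where "V' = V - {x, y}"
    define E' where "E' = E \<inter> nsets V' 2"
    have card: "card V = card V' + 2"
    proof -
      have "card {x, y} \<le> card V" using xy less.prems(1) by (intro card_mono) auto
      thus ?thesis using xy less.prems(1) by (simp add: V'_def card_Diff_subset)
    qed
    have IH: "4 * card E' \<le> (card V')\<^sup>2"
    proof (rule less.hyps)
      show "\<not> (\<exists>W\<subseteq>V'. card W = 3 \<and> nsets W 2 \<subseteq> E')"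
        using less.prems(3) by (auto simp: V'_def E'_def)
    qed (use card less.prems(1) in \<open>auto simp: V'_def E'_def\<close>)
    have new_edges: "E - E' \<subseteq> insert {x, y} ((\<lambda>z. if {x, z} \<in> E then {x, z} else {y, z}) ` V')"
    proof
      fix d assume d: "d \<in> E - E'"
      then obtain u v where uv: "d = {u, v}" "u \<noteq> v" "u \<in> V" "v \<in> V"
        using less.prems(2) by (metis DiffD1 nsets2_E subsetD)
      have "\<not> d \<subseteq> V'" using d less.prems(2) by (auto simp: E'_def nsets_def)
      then obtain w z where wz: "d = {w, z}" "w = x \<or> w = y" "z \<in> V" "z \<noteq> w"
        using uv by (auto simp: V'_def)
      show "d \<in> insert {x, y} ((\<lambda>z. if {x, z} \<in> E then {x, z} else {y, z}) ` V')"
      proof (cases "z \<in> {x, y}")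
        case True
        thus ?thesis using wz by auto
      next
        case False
        hence "z \<in> V'" using wz by (simp add: V'_def)
        moreover have "d = (if {x, z} \<in> E then {x, z} else {y, z})"
        proof (cases "w = x")
          case True
          thus ?thesis using d wz by auto
        next
          case wy: False
          have "{x, z} \<notin> E"
          proof
            assume "{x, z} \<in> E"
            moreover have "{y, z} \<in> E" using d wz wy by auto
            ultimately have "nsets {x, y, z} 2 \<subseteq> E"
              using xy False by (subst nsets_triangle) auto
            moreover have "card {x, y, z} = 3" "{x, y, z} \<subseteq> V" using xy wz False by auto
            ultimately have "\<exists>W\<subseteq>V. card W = 3 \<and> nsets W 2 \<subseteq> E"
              by (intro exI[of _ "{x, y, z}"] conjI)
            thus False using less.prems(3) by contradiction
          qed
          thus ?thesis using wz wy by auto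
        qed
        ultimately show ?thesis by blast
      qed
    qed
    have "finite V'" using less.prems(1) by (simp add: V'_def)
    hence "card (E - E') \<le> card (insert {x, y} ((\<lambda>z. if {x, z} \<in> E then {x, z} else {y, z}) ` V'))"
      by (intro card_mono new_edges) auto
    also have "\<dots> \<le> Suc (card ((\<lambda>z. if {x, z} \<in> E then {x, z} else {y, z}) ` V'))"
      using \<open>finite V'\<close> by (simp add: card_insert_if)
    also have "\<dots> \<le> Suc (card V')" using card_image_le[OF \<open>finite V'\<close>] by blast
    finally have "card (E - E') \<le> Suc (card V')" .
    moreover have "card E \<le> card E' + card (E - E')"
    proof -
      have "E = E' \<union> (E - E')" by (auto simp: E'_def)
      thus ?thesis using card_Un_le[of E' "E - E'"] by simp
    qed
    ultimately show ?thesis using IH by (simp add: card power2_eq_square)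
  qed simp
qed

definition bipartite_edges :: "nat \<Rightarrow> nat \<Rightarrow> nat set set" where
  "bipartite_edges m n = {{x, y} | x y. x < m \<and> m \<le> y \<and> y < n}"

lemma bipartite_edges_subset: "bipartite_edges m n \<subseteq> nsets {..<n} 2"
  by (auto simp: bipartite_edges_def nsets_def)

lemma bipartite_edges_sides:
  assumes "{x, y} \<in> bipartite_edges m n" shows "x < m \<longleftrightarrow> \<not> y < m"
  using assms by (auto simp: bipartite_edges_def doubleton_eq_iff)

lemma card_bipartite_edges: "card (bipartite_edges m n) = m * (n - m)"
proof -
  have "bipartite_edges m n = (\<lambda>(x, y). {x, y}) ` ({..<m} \<times> {m..<n})"
    unfolding bipartite_edges_def by force
  moreover have "inj_on (\<lambda>(x, y). {x, y}) ({..<m} \<times> {m..<n})"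
    by (auto simp: inj_on_def doubleton_eq_iff)
  ultimately show ?thesis by (simp add: card_image)
qed

lemma half_half_bound: "n\<^sup>2 \<le> 4 * (n div 2 * (n - n div 2)) + 1" for n :: nat
proof (cases "even n")
  case True
  then obtain k where "n = 2 * k" by (elim evenE)
  thus ?thesis by (simp add: power2_eq_square)
next
  case False
  then obtain k where "n = 2 * k + 1" by (elim oddE)
  thus ?thesis by (simp add: power2_eq_square algebra_simps)
qed

lemma ex_ge_bipartite:
  assumes "r \<ge> 3"
  shows "n div 2 * (n - n div 2) \<le> ex n (complete_graph r)"
proof -
  have "\<not> nsets W 2 \<subseteq> bipartite_edges (n div 2) n" if W: "card W = r" for W
  proof
    assume sub: "nsets W 2 \<subseteq> bipartite_edges (n div 2) n"
    obtain T where "T \<subseteq> W" "card T = 3" using W assms by (metis obtain_subset_with_card_n)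
    then obtain x y z where xyz: "T = {x, y, z}" "x \<noteq> y" "x \<noteq> z" "y \<noteq> z"
      by (auto simp: card_3_iff)
    have "nsets T 2 \<subseteq> nsets W 2" using \<open>T \<subseteq> W\<close> by (rule nsets_mono)
    hence "{x, y} \<in> bipartite_edges (n div 2) n" "{x, z} \<in> bipartite_edges (n div 2) n"
      "{y, z} \<in> bipartite_edges (n div 2) n"
      using sub nsets_triangle[OF xyz(2-)] xyz(1) by auto
    thus False using bipartite_edges_sides by blast
  qed
  hence "copies (complete_graph r) ({..<n}, bipartite_edges (n div 2) n) = {}"
    unfolding clique_free_iff by blast
  from ex_ge[OF bipartite_edges_subset this] show ?thesis by (simp add: card_bipartite_edges)
qed

lemma ex_triangle_le: "4 * ex n (complete_graph 3) \<le> n\<^sup>2"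
proof -
  obtain E where E: "E \<subseteq> nsets {..<n} 2" "copies (complete_graph 3) ({..<n}, E) = {}"
    "card E = ex n (complete_graph 3)"
    using ex_attained[of 3 n] by auto
  have "4 * card E \<le> (card {..<n})\<^sup>2"
    by (rule mantel[OF _ E(1)]) (use E(2) finite_subset in \<open>auto simp: clique_free_iff\<close>)
  thus ?thesis using E(3) by simp
qed

lemma ex_edge: "ex n (complete_graph 2) = 0"
proof -
  obtain E where E: "E \<subseteq> nsets {..<n} 2" "copies (complete_graph 2) ({..<n}, E) = {}"
    "card E = ex n (complete_graph 2)"
    using ex_attained[of 2 n, OF order_refl] by (elim exE conjE)
  have "e \<notin> E" for e
  proof
    assume e: "e \<in> E"
    then obtain u v where uv: "e = {u, v}" "u \<in> {..<n}" "v \<in> {..<n}" "u \<noteq> v"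
      using E(1) by (meson nsets2_E subsetD)
    hence "e \<subseteq> {..<n}" "finite e" "card e = 2" "nsets e 2 \<subseteq> E" using e by auto
    hence "\<exists>W\<subseteq>{..<n}. finite W \<and> card W = 2 \<and> nsets W 2 \<subseteq> E" by (intro exI[of _ e] conjI)
    thus False using E(2) unfolding clique_free_iff by contradiction
  qed
  hence "E = {}" by blast
  thus ?thesis using E(3) by simp
qed

section \<open>Colourings with many colours and no proper copy\<close>

lemma rainbow_plus_one_colour:
  fixes E :: "'a set set"
  assumes "E \<subseteq> F" "finite F"
  shows "\<exists>\<chi> :: 'a set \<Rightarrow> nat. card E \<le> card (\<chi> ` F) \<and> (\<forall>e. e \<notin> E \<longrightarrow> \<chi> e = 0)"
proof -
  have "finite E" using assms finite_subset by blast
  then obtain g :: "'a set \<Rightarrow> nat" where "bij_betw g E {0..<card E}"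
    using ex_bij_betw_finite_nat[of E] by auto
  hence g: "inj_on g E" by (rule bij_betw_imp_inj_on)
  let ?\<chi> = "\<lambda>e. if e \<in> E then Suc (g e) else 0"
  have "card E = card (?\<chi> ` E)" using g by (intro card_image[symmetric]) (auto simp: inj_on_def)
  also have "\<dots> \<le> card (?\<chi> ` F)" using assms by (intro card_mono image_mono) auto
  finally show ?thesis by (intro exI[of _ ?\<chi>]) auto
qed

text \<open>
  Let \<open>C\<close> be a largest clique of \<open>E\<close> inside \<open>W\<close>. Every vertex of \<open>W - C\<close> has a non-neighbour in \<open>C\<close>, and
  different vertices have different ones because the non-edges all have the colour \<open>c0\<close> and thus
  form a matching. Hence \<open>C\<close> contains at least half of \<open>W\<close>.
\<close>

lemma clique_if_complement_matching:
  assumes W: "finite W" "2 * r - 1 \<le> card W" and "r \<ge> 1"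
    and proper: "proper_on \<chi> (nsets W 2)" and c0: "\<And>e. e \<in> nsets W 2 \<Longrightarrow> e \<notin> E \<Longrightarrow> \<chi> e = c0"
  shows "\<exists>C\<subseteq>W. card C = r \<and> nsets C 2 \<subseteq> E"
proof -
  define S where "S = {C. C \<subseteq> W \<and> nsets C 2 \<subseteq> E}"
  have "finite S" using W(1) by (simp add: S_def)
  have "{} \<in> S" by (auto simp: S_def nsets_def)
  have "Max (card ` S) \<in> card ` S" by (rule Max_in) (use \<open>finite S\<close> \<open>{} \<in> S\<close> in auto)
  then obtain C where C: "C \<in> S" "card C = Max (card ` S)" by auto
  have maximal: "card D \<le> card C" if "D \<in> S" for D
    unfolding C(2) by (rule Max_ge) (use \<open>finite S\<close> that in auto)
  have CW: "C \<subseteq> W" "finite C" using C(1) W(1) finite_subset by (auto simp: S_def)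
  have "\<forall>w\<in>W - C. \<exists>c. c \<in> C \<and> {w, c} \<notin> E"
  proof
    fix w assume w: "w \<in> W - C"
    have "insert w C \<notin> S" using maximal[of "insert w C"] w CW by auto
    then obtain e where e: "e \<in> nsets (insert w C) 2" "e \<notin> E" using w CW by (auto simp: S_def)
    have "e \<notin> nsets C 2" using C(1) e(2) by (auto simp: S_def)
    hence "w \<in> e" using e(1) by (auto simp: nsets_def)
    then obtain c where "e = {w, c}" "c \<noteq> w" using e(1) by (auto simp: nsets_def card_2_iff)
    thus "\<exists>c. c \<in> C \<and> {w, c} \<notin> E" using e by (auto simp: nsets_def)
  qed
  from bchoice[OF this] obtain g where g: "\<forall>w\<in>W - C. g w \<in> C \<and> {w, g w} \<notin> E" ..
  have "inj_on g (W - C)"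
  proof (rule inj_onI, rule ccontr)
    fix w w' assume w: "w \<in> W - C" "w' \<in> W - C" "g w = g w'" "w \<noteq> w'"
    have pair: "{v, g v} \<in> nsets W 2 \<and> \<chi> {v, g v} = c0" if "v \<in> W - C" for v
    proof -
      have "g v \<in> C" using g that by blast
      hence "{v, g v} \<in> nsets W 2" using that CW by (auto simp: doubleton_in_nsets_2)
      thus ?thesis using c0 g that by blast
    qed
    have "{w, g w} \<noteq> {w', g w'}" using w g by (auto simp: doubleton_eq_iff)
    hence "{w, g w} \<inter> {w', g w'} = {}"
      using proper pair[OF w(1)] pair[OF w(2)] by (simp add: proper_on_def)
    thus False using w(3) by auto
  qed
  hence "card (W - C) \<le> card C" by (rule card_inj_on_le) (use g CW in auto)
  moreover have "card W = card C + card (W - C)"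
    using CW W(1) by (simp add: card_Diff_subset card_mono)
  ultimately have "r \<le> card C" using W(2) \<open>r \<ge> 1\<close> by linarith
  then obtain D where D: "D \<subseteq> C" "card D = r" by (metis obtain_subset_with_card_n)
  have "nsets D 2 \<subseteq> nsets C 2" using D(1) by (rule nsets_mono)
  thus ?thesis using D CW(1) C(1) by (intro exI[of _ D]) (auto simp: S_def)
qed

lemma ex_less_Lr_complete_graph:
  assumes "r \<ge> 2" "2 * r - 1 \<le> p"
  shows "ex n (complete_graph r) < Lr n (complete_graph p)"
proof -
  obtain E where E: "E \<subseteq> nsets {..<n} 2" "copies (complete_graph r) ({..<n}, E) = {}"
    "card E = ex n (complete_graph r)"
    using ex_attained[OF assms(1)] by blast
  obtain \<chi> :: "nat set \<Rightarrow> nat" where \<chi>: "card E \<le> card (\<chi> ` nsets {..<n} 2)" "\<forall>e. e \<notin> E \<longrightarrow> \<chi> e = 0"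
    using rainbow_plus_one_colour[OF E(1)] by (auto simp: finite_imp_finite_nsets)
  show ?thesis
  proof (rule less_Lr)
    show "ex n (complete_graph r) \<le> card (\<chi> ` nsets {..<n} 2)" using \<chi>(1) E(3) by simp
    fix S assume "S \<in> copies (complete_graph p) (complete_graph n)"
    then obtain W where W: "S = (W, nsets W 2)" "W \<subseteq> {..<n}" "finite W" "card W = p"
      unfolding copies_complete_graph by (auto simp: complete_graph_def)
    show "\<not> proper_on \<chi> (edges S)"
    proof
      assume "proper_on \<chi> (edges S)"
      hence "\<exists>C\<subseteq>W. card C = r \<and> nsets C 2 \<subseteq> E"
        using W assms \<chi>(2) by (intro clique_if_complement_matching[of W r \<chi> E 0]) simp_all
      then obtain C where C: "C \<subseteq> W" "card C = r" "nsets C 2 \<subseteq> E" by (elim exE conjE)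
      moreover have "C \<subseteq> {..<n}" "finite C" using C(1) W finite_subset by auto
      ultimately have "\<exists>W\<subseteq>{..<n}. finite W \<and> card W = r \<and> nsets W 2 \<subseteq> E"
        by (intro exI[of _ C] conjI)
      thus False using E(2) unfolding clique_free_iff by contradiction
    qed
  qed
qed

text \<open>
  Cyclic successors in the form needed for the rim: the three vertices after \<open>i\<close> differ from \<open>i\<close>. For
  \<open>k = 3\<close> the third of them would be \<open>i\<close> itself; this is where \<open>k \<ge> 4\<close> enters.
\<close>

lemma cyclic_successors_distinct:
  assumes "k \<ge> 4" "i < k"
  defines "s \<equiv> \<lambda>j. Suc j mod k"
  shows "s i \<noteq> i" "s (s i) \<noteq> i" "s (s (s i)) \<noteq> i" "s (s (s i)) \<noteq> s i"
    "s i < k" "s (s i) < k" "s (s (s i)) < k"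
proof -
  have lt: "s j < k" for j using assms(1) by (simp add: s_def)
  have s: "s j = (if Suc j = k then 0 else Suc j)" if "j < k" for j using that by (simp add: s_def)
  show "s i < k" "s (s i) < k" "s (s (s i)) < k" by (rule lt)+
  have *: "a \<noteq> i \<and> b \<noteq> i \<and> c \<noteq> i \<and> c \<noteq> a"
    if "a = (if Suc i = k then 0 else Suc i)" "b = (if Suc a = k then 0 else Suc a)"
      "c = (if Suc b = k then 0 else Suc b)" for a b c
    using that assms(1,2)
    by (cases "Suc i = k"; cases "Suc a = k"; cases "Suc b = k"; simp; linarith)
  show "s i \<noteq> i" "s (s i) \<noteq> i" "s (s (s i)) \<noteq> i" "s (s (s i)) \<noteq> s i"
    using *[OF s[OF assms(2)] s[OF lt] s[OF lt]] by blast+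
qed

text \<open>
  Two edges that meet cannot both run inside a side of the bipartition. Hence at most one rim vertex
  \<open>f i0\<close> is on the side of the hub, and the three rim vertices after it form a path inside the other
  side.
\<close>

lemma no_proper_wheel:
  assumes S: "S \<in> copies (wheel_graph k) (complete_graph n)" and "k \<ge> 4"
    and c0: "\<forall>e. e \<notin> bipartite_edges m n \<longrightarrow> \<chi> e = c0"
  shows "\<not> proper_on \<chi> (edges S)"
proof
  assume proper: "proper_on \<chi> (edges S)"
  obtain \<phi> where inj: "inj_on \<phi> (verts (wheel_graph k))"
    and edges: "edges S = (\<lambda>e. \<phi> ` e) ` edges (wheel_graph k)"
    using S by (auto simp: copies_def graph_iso_def bij_betw_def)
  define f where "f i = \<phi> (Inl i)" for i
  define c where "c = \<phi> (Inr 0)"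
  have injf: "f i \<noteq> f j" if "i < k" "j < k" "i \<noteq> j" for i j
    using inj that by (auto simp: f_def inj_on_def verts_wheel_graph)
  have fc: "f i \<noteq> c" if "i < k" for i
    using inj that by (auto simp: f_def c_def inj_on_def verts_wheel_graph)
  have spoke: "{f i, c} \<in> edges S" if "i < k" for i
  proof -
    have "\<phi> ` {Inl i, Inr 0} \<in> edges S"
      unfolding edges edges_wheel_graph using that by (intro imageI) blast
    thus ?thesis by (simp add: f_def c_def)
  qed
  have rim: "{f i, f (Suc i mod k)} \<in> edges S" if "i < k" for i
  proof -
    have "\<phi> ` {Inl i, Inl (Suc i mod k)} \<in> edges S"
      unfolding edges edges_wheel_graph using that by (intro imageI) blast
    thus ?thesis by (simp add: f_def)
  qed
  have not_all_one_side: "x \<noteq> z \<Longrightarrow> (x < m) \<noteq> (y < m) \<or> (y < m) \<noteq> (z < m)"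
    if "{x, y} \<in> edges S" "{z, y} \<in> edges S" for x y z
  proof (rule ccontr)
    assume "x \<noteq> z" "\<not> ((x < m) \<noteq> (y < m) \<or> (y < m) \<noteq> (z < m))"
    hence "\<chi> {x, y} = c0" "\<chi> {z, y} = c0" using c0 bipartite_edges_sides by blast+
    moreover have "{x, y} \<noteq> {z, y}" using \<open>x \<noteq> z\<close> by (auto simp: doubleton_eq_iff)
    ultimately have "{x, y} \<inter> {z, y} = {}" using proper that by (simp add: proper_on_def)
    thus False by auto
  qed
  have "\<exists>i0<k. \<forall>i<k. i \<noteq> i0 \<longrightarrow> (f i < m) \<noteq> (c < m)"
  proof (cases "\<exists>i0<k. (f i0 < m) = (c < m)")
    case True
    then obtain i0 where "i0 < k" "(f i0 < m) = (c < m)" by blast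
    thus ?thesis using not_all_one_side[OF spoke[of i0] spoke] injf by metis
  next
    case False
    thus ?thesis using \<open>k \<ge> 4\<close> by (intro exI[of _ 0]) auto
  qed
  then obtain i0 where i0: "i0 < k" "\<forall>i<k. i \<noteq> i0 \<longrightarrow> (f i < m) \<noteq> (c < m)" by blast
  define s where "s j = Suc j mod k" for j
  note dist = cyclic_successors_distinct[OF \<open>k \<ge> 4\<close> i0(1), folded s_def]
  have path: "{f (s i0), f (s (s i0))} \<in> edges S" "{f (s (s (s i0))), f (s (s i0))} \<in> edges S"
    using rim[OF dist(5)] rim[OF dist(6)] by (simp_all add: s_def insert_commute)
  have "f (s i0) \<noteq> f (s (s (s i0)))" by (rule injf[OF dist(5) dist(7) dist(4)[symmetric]])
  moreover have "(f j < m) \<noteq> (c < m)" if "j < k" "j \<noteq> i0" for j using i0(2) that by blast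
  note this[OF dist(5) dist(1)] this[OF dist(6) dist(2)] this[OF dist(7) dist(3)]
  ultimately show False using not_all_one_side[OF path] by blast
qed

lemma bipartite_less_Lr_wheel:
  assumes "k \<ge> 4"
  shows "n div 2 * (n - n div 2) < Lr n (wheel_graph k)"
proof -
  let ?E = "bipartite_edges (n div 2) n"
  obtain \<chi> :: "nat set \<Rightarrow> nat" where \<chi>: "card ?E \<le> card (\<chi> ` nsets {..<n} 2)"
    "\<forall>e. e \<notin> ?E \<longrightarrow> \<chi> e = 0"
    using rainbow_plus_one_colour[OF bipartite_edges_subset[of "n div 2" n]]
    by (auto simp: finite_imp_finite_nsets)
  show ?thesis
    by (rule less_Lr[OF \<chi>(1)[unfolded card_bipartite_edges]]) (rule no_proper_wheel[OF _ assms \<chi>(2)])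
qed

section \<open>Asymptotics\<close>

text \<open>
  One edge of each colour gives a rainbow graph \<open>E\<close> with as many edges as there are colours. If
  large rainbow complete \<open>r\<close>-partite graphs force a properly coloured \<open>G\<close>, then \<open>erdos_stone\<close> applied
  to \<open>E\<close> bounds the number of colours.
\<close>

lemma Lr_upper_bound:
  assumes forces: "\<And>n E (\<chi> :: nat set \<Rightarrow> nat). E \<subseteq> nsets {..<n} 2 \<Longrightarrow> inj_on \<chi> E \<Longrightarrow>
      multipartite_in r (\<lambda>_. t) {..<n} E \<Longrightarrow>
      \<exists>S\<in>copies G (complete_graph n). proper_on \<chi> (edges S)"
    and "\<epsilon> > 0"
  shows "\<forall>\<^sub>F n in at_top. real (Lr n G) \<le> real (ex n (complete_graph r)) + \<epsilon> * (real n)\<^sup>2"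
proof -
  have "\<epsilon> / 2 > 0" using assms(2) by simp
  from erdos_stone[OF this, of r t] obtain N where
    N: "\<forall>n\<ge>N. \<forall>E \<subseteq> nsets {..<n} 2.
    real (ex n (complete_graph r)) + \<epsilon> / 2 * (real n)\<^sup>2 \<le> real (card E) \<longrightarrow>
    multipartite_in r (\<lambda>_. t) {..<n} E" ..
  show ?thesis
    unfolding eventually_sequentially
    \<comment> \<open>The bound \<open>4 / \<epsilon> \<le> n\<close> makes \<open>\<epsilon> / 2 * n\<^sup>2\<close> absorb the rounding error \<open>2\<close>.\<close>
  proof (intro exI[of _ "max N (nat \<lceil>4 / \<epsilon>\<rceil> + 1)"] allI impI)
    fix n assume "max N (nat \<lceil>4 / \<epsilon>\<rceil> + 1) \<le> n"
    hence n: "N \<le> n" "4 / \<epsilon> \<le> real n" "1 \<le> real n" by linarith+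
    define k where "k = nat \<lceil>real (ex n (complete_graph r)) + \<epsilon> / 2 * (real n)\<^sup>2\<rceil> + 1"
    have "Lr n G \<le> k"
    proof (rule Lr_le)
      fix \<chi> :: "nat set \<Rightarrow> nat" assume k: "k \<le> card (\<chi> ` nsets {..<n} 2)"
      obtain E where E: "E \<subseteq> nsets {..<n} 2" "inj_on \<chi> E" "\<chi> ` nsets {..<n} 2 = \<chi> ` E"
        using subset_image_inj[of "\<chi> ` nsets {..<n} 2" \<chi> "nsets {..<n} 2"] by auto
      have "card (\<chi> ` nsets {..<n} 2) = card E" using E(2,3) by (simp add: card_image)
      hence "real (ex n (complete_graph r)) + \<epsilon> / 2 * (real n)\<^sup>2 \<le> real (card E)"
        using k unfolding k_def by linarith
      thus "\<exists>S\<in>copies G (complete_graph n). proper_on \<chi> (edges S)"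
        using N n(1) E by (intro forces[of E]) blast+
    qed (simp add: k_def)
    moreover have "real k \<le> real (ex n (complete_graph r)) + \<epsilon> / 2 * (real n)\<^sup>2 + 2"
    proof -
      have "0 \<le> real (ex n (complete_graph r)) + \<epsilon> / 2 * (real n)\<^sup>2" using assms(2) by simp
      thus ?thesis unfolding k_def by linarith
    qed
    moreover have "2 \<le> \<epsilon> / 2 * (real n)\<^sup>2"
    proof -
      have "4 \<le> \<epsilon> * real n" using n(2) assms(2) by (simp add: field_simps)
      also have "\<dots> \<le> \<epsilon> * (real n * real n)"
        using n(3) assms(2) by (intro mult_left_mono) auto
      finally show ?thesis by (simp add: power2_eq_square)
    qed
    ultimately show "real (Lr n G) \<le> real (ex n (complete_graph r)) + \<epsilon> * (real n)\<^sup>2"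
      by linarith
  qed
qed

lemma Lr_complete_graph_near_ex:
  assumes "r \<ge> 2" "2 * r - 1 \<le> p" "p \<le> 2 * r"
  shows "(\<lambda>n. real (Lr n (complete_graph p)) - real (ex n (complete_graph r)))
    \<in> o[at_top](\<lambda>n. (real n)\<^sup>2)"
proof (rule landau_o.smallI)
  fix \<epsilon> :: real assume "\<epsilon> > 0"
  from proper_clique_in_rainbow_multipartite[of r] obtain t where
    t: "\<forall>(V :: nat set) E (\<chi> :: nat set \<Rightarrow> nat). finite V \<longrightarrow> E \<subseteq> nsets V 2 \<longrightarrow> inj_on \<chi> E \<longrightarrow>
     multipartite_in r (\<lambda>_. t) V E \<longrightarrow>
     (\<exists>W\<subseteq>V. card W = 2 * r \<and> proper_on \<chi> (nsets W 2))" ..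
  have "\<forall>\<^sub>F n in at_top. real (Lr n (complete_graph p))
      \<le> real (ex n (complete_graph r)) + \<epsilon> * (real n)\<^sup>2"
  proof (rule Lr_upper_bound[OF _ \<open>\<epsilon> > 0\<close>])
    fix n E and \<chi> :: "nat set \<Rightarrow> nat"
    assume "E \<subseteq> nsets {..<n} 2" "inj_on \<chi> E" "multipartite_in r (\<lambda>_. t) {..<n} E"
    with t obtain W where W: "W \<subseteq> {..<n}" "card W = 2 * r" "proper_on \<chi> (nsets W 2)"
      by (metis finite_lessThan)
    obtain U where U: "U \<subseteq> W" "card U = p" using W(2) assms(3) by (metis obtain_subset_with_card_n)
    have sub: "nsets U 2 \<subseteq> nsets W 2" "nsets U 2 \<subseteq> nsets {..<n} 2"
      using U(1) W(1) by (auto intro!: nsets_mono)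
    have "proper_on \<chi> (nsets U 2)" using W(3) sub(1) by (auto simp: proper_on_def)
    moreover have "(U, nsets U 2) \<in> copies (complete_graph p) (complete_graph n)"
      using U W(1) sub(2) finite_subset[of U "{..<n}"]
      unfolding copies_complete_graph by (auto simp: complete_graph_def)
    ultimately show "\<exists>S\<in>copies (complete_graph p) (complete_graph n). proper_on \<chi> (edges S)"
      by (intro bexI[of _ "(U, nsets U 2)"]) auto
  qed
  thus "\<forall>\<^sub>F n in at_top. norm (real (Lr n (complete_graph p)) - real (ex n (complete_graph r)))
      \<le> \<epsilon> * norm ((real n)\<^sup>2)"
  proof eventually_elim
    case (elim n)
    thus ?case using ex_less_Lr_complete_graph[OF assms(1,2), of n] by simp
  qed
qed

lemma square_bigo_ex:
  assumes "r \<ge> 3"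
  shows "(\<lambda>n. (real n)\<^sup>2) \<in> O[at_top](\<lambda>n. real (ex n (complete_graph r)))"
proof (rule landau_o.bigI[of 8])
  show "\<forall>\<^sub>F n in at_top. norm ((real n)\<^sup>2) \<le> 8 * norm (real (ex n (complete_graph r)))"
    using eventually_ge_at_top[of 2]
  proof eventually_elim
    case (elim n)
    define X where "X = n div 2 * (n - n div 2)"
    have "n\<^sup>2 \<le> 4 * X + 1" "X \<le> ex n (complete_graph r)"
      unfolding X_def by (rule half_half_bound ex_ge_bipartite[OF assms])+
    moreover have "2 \<le> n\<^sup>2" using elim power_mono[of 2 n 2] by simp
    ultimately have "n\<^sup>2 \<le> 8 * ex n (complete_graph r)" by linarith
    thus ?case by (simp flip: of_nat_power)
  qed
qed simp

lemma Lr_wheel_near_quarter: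
  assumes "k \<ge> 4"
  shows "(\<lambda>n. real (Lr n (wheel_graph k)) - (real n)\<^sup>2 / 4) \<in> o[at_top](\<lambda>n. (real n)\<^sup>2)"
proof (rule landau_o.smallI)
  fix \<epsilon> :: real assume "\<epsilon> > 0"
  have "\<forall>\<^sub>F n in at_top. real (Lr n (wheel_graph k))
      \<le> real (ex n (complete_graph 3)) + \<epsilon> * (real n)\<^sup>2"
    by (rule Lr_upper_bound[OF proper_wheel_in_rainbow_tripartite \<open>\<epsilon> > 0\<close>]) (use assms in auto)
  thus "\<forall>\<^sub>F n in at_top. norm (real (Lr n (wheel_graph k)) - (real n)\<^sup>2 / 4) \<le> \<epsilon> * norm ((real n)\<^sup>2)"
  proof eventually_elim
    case (elim n)
    have upper: "4 * real (ex n (complete_graph 3)) \<le> (real n)\<^sup>2"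
      using ex_triangle_le[of n] by (metis of_nat_le_iff of_nat_mult of_nat_numeral of_nat_power)
    define X where "X = n div 2 * (n - n div 2)"
    have "n\<^sup>2 \<le> 4 * X + 1" "X < Lr n (wheel_graph k)"
      unfolding X_def by (rule half_half_bound bipartite_less_Lr_wheel[OF assms])+
    hence "n\<^sup>2 \<le> 4 * Lr n (wheel_graph k)" by linarith
    hence "(real n)\<^sup>2 \<le> 4 * real (Lr n (wheel_graph k))"
      by (metis of_nat_le_iff of_nat_mult of_nat_numeral of_nat_power)
    with upper show ?case using elim by simp
  qed
qed

theorem theorem5p2:
  "(\<forall>p\<ge>5. (\<lambda>n. real (Lr n (complete_graph p)))
        \<sim>[at_top] (\<lambda>n. real (ex n (complete_graph (nat \<lceil>real p / 2\<rceil>))))) \<and>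
   (\<forall>q\<ge>2. (\<lambda>n. real (Lr n (complete_graph (2 * q))) - real (Lr n (complete_graph (2 * q - 1))))
        \<in> o[at_top](\<lambda>n. (real n)\<^sup>2)) \<and>
   (\<lambda>n. real (Lr n (complete_graph 4))) \<in> o[at_top](\<lambda>n. (real n)\<^sup>2) \<and>
   (\<forall>k\<ge>4. (\<lambda>n. real (Lr n (wheel_graph k))) \<sim>[at_top] (\<lambda>n. (real n)\<^sup>2 / 4))"
proof (intro conjI allI impI)
  fix p :: nat assume "p \<ge> 5"
  define r where "r = nat \<lceil>real p / 2\<rceil>"
  have r: "2 * r - 1 \<le> p" "p \<le> 2 * r" "r \<ge> 3" using \<open>p \<ge> 5\<close> unfolding r_def by linarith+
  have "(\<lambda>n. real (Lr n (complete_graph p)) - real (ex n (complete_graph r)))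
      \<in> o[at_top](\<lambda>n. (real n)\<^sup>2)"
    using r by (intro Lr_complete_graph_near_ex) auto
  from landau_o.small_big_trans[OF this square_bigo_ex[OF r(3)]]
  show "(\<lambda>n. real (Lr n (complete_graph p))) \<sim>[at_top] (\<lambda>n. real (ex n (complete_graph r)))"
    by (simp add: asymp_equiv_altdef)
next
  fix q :: nat assume "q \<ge> 2"
  let ?D = "\<lambda>p n. real (Lr n (complete_graph p)) - real (ex n (complete_graph q))"
  have "?D (2 * q) \<in> o[at_top](\<lambda>n. (real n)\<^sup>2)" "?D (2 * q - 1) \<in> o[at_top](\<lambda>n. (real n)\<^sup>2)"
    using \<open>q \<ge> 2\<close> by (intro Lr_complete_graph_near_ex; simp)+
  hence "(\<lambda>n. ?D (2 * q) n - ?D (2 * q - 1) n) \<in> o[at_top](\<lambda>n. (real n)\<^sup>2)"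
    by (rule sum_in_smallo)
  thus "(\<lambda>n. real (Lr n (complete_graph (2 * q))) - real (Lr n (complete_graph (2 * q - 1))))
        \<in> o[at_top](\<lambda>n. (real n)\<^sup>2)" by simp
next
  show "(\<lambda>n. real (Lr n (complete_graph 4))) \<in> o[at_top](\<lambda>n. (real n)\<^sup>2)"
    using Lr_complete_graph_near_ex[of 2 4] by (simp add: ex_edge)
next
  fix k :: nat assume "k \<ge> 4"
  from Lr_wheel_near_quarter[OF this]
  show "(\<lambda>n. real (Lr n (wheel_graph k))) \<sim>[at_top] (\<lambda>n. (real n)\<^sup>2 / 4)"
    by (simp add: asymp_equiv_altdef)
qed

end
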